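(* Let $G$ be a finite group with presentation determined by $F/R$, that is, $F$ is a free group, $R$ is a normal subgroup of $F$, and $G=F/R$. Let $A=\mathbb{Q}/\mathbb{Z}$. Then the transgression map $$\mathrm{tra}: \mathrm{Hom}\big(R/\langle K(F)\cap R\rangle, A\big)\to \mathrm{B}_0(G)$$ corresponding to the exact sequence $$1\to R/\langle K(F)\cap R\rangle\to F/\langle K(F)\cap R\rangle\to G\to 1$$ is surjective. Consequently, $$\mathrm{B}_0(G)\cong \mathrm{Hom}\Big(\frac{F'\cap R}{\langle K(F)\cap R\rangle},\mathbb{Q}/\mathbb{Z}\Big).$$
   Context: For a group $X$, $[x,y]=x^{-1}y^{-1}xy$, $X'$ is the commutator subgroup, and $K(X)=\{[x,y]\mid x,y\in X\}$ is the set of commutators; $\langle T\rangle$ denotes the subgroup generated by a set $T$. $\mathbb{Q}/\mathbb{Z}$ is regarded as a trivial module. For a finite group $G$, the Bogomolov multiplier is $$\mathrm{B}_0(G)=\bigcap_{A\le G,\ A\text{ abelian}}\ker\big(\mathrm{res}^G_A: \mathrm{H}^2(G,\mathbb{Q}/\mathbb{Z})\to \mathrm{H}^2(A,\mathbb{Q}/\mathbb{Z})\big).$$ Transgression: for an exact sequence $1\to M\to E\xrightarrow{\pi} G\to 1$ with $M$ central in $E$ and a section $\mu:G\to E$ of $\pi$, the map $\mathrm{tra}:\mathrm{Hom}(M,\mathbb{Q}/\mathbb{Z})\to \mathrm{H}^2(G,\mathbb{Q}/\mathbb{Z})$ sends $\chi$ to the class of the 2-cocycle $\alpha(x,y)=\chi(\mu(x)\mu(y)\mu(xy)^{-1})$.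 For the sequence in the claim, the image of $\mathrm{tra}$ lies in $\mathrm{B}_0(G)$. *)

theory Defs
  imports "HOL-Algebra.Algebra" "HOL-Algebra.Product_Groups"
begin

section \<open>Free groups and commutators\<close>

text \<open>A letter \<open>(x, True)\<close> stands for \<open>x\<close> and \<open>(x, False)\<close> for the inverse of \<open>x\<close>.\<close>

definition word_val :: "('a, 'm) monoid_scheme \<Rightarrow> ('a \<times> bool) list \<Rightarrow> 'a" where
  "word_val F w = foldr (\<lambda>(x, b) y. (if b then x else inv\<^bsub>F\<^esub> x) \<otimes>\<^bsub>F\<^esub> y) w \<one>\<^bsub>F\<^esub>"

definition reduced_words :: "'a set \<Rightarrow> ('a \<times> bool) list set" where
  "reduced_words S =
     {w \<in> lists (S \<times> UNIV). successively (\<lambda>(x, b) (y, c). \<not> (x = y \<and> b \<noteq> c)) w}"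

text \<open>\<open>S\<close> is a free basis of \<open>F\<close> if every element of \<open>F\<close> is the value of exactly one
  reduced word in \<open>S\<close>. The basis may be infinite, or empty.\<close>

definition free_basis :: "('a, 'm) monoid_scheme \<Rightarrow> 'a set \<Rightarrow> bool" where
  "free_basis F S \<longleftrightarrow> S \<subseteq> carrier F \<and> bij_betw (word_val F) (reduced_words S) (carrier F)"

definition free_group :: "('a, 'm) monoid_scheme \<Rightarrow> bool" where
  "free_group F \<longleftrightarrow> group F \<and> (\<exists>S. free_basis F S)"

text \<open>The set of commutators itself, not the subgroup it generates; the commutator subgroup
  of \<open>G\<close> is \<open>derived G (carrier G)\<close>.\<close>

definition commutators :: "('a, 'm) monoid_scheme \<Rightarrow> 'a set" where
  "commutators G =
     {inv\<^bsub>G\<^esub> x \<otimes>\<^bsub>G\<^esub> inv\<^bsub>G\<^esub> y \<otimes>\<^bsub>G\<^esub> x \<otimes>\<^bsub>G\<^esub> y | x y. x \<in> carrier G \<and> y \<in> carrier G}"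


section \<open>The coefficient group and groups of homomorphisms\<close>

definition rat_group :: "rat monoid" where
  "rat_group = \<lparr>carrier = UNIV, monoid.mult = (+), one = 0\<rparr>"

definition QZ :: "rat set monoid" where
  "QZ = rat_group Mod \<int>"

text \<open>Homomorphisms are made extensional, so that equal maps on the carrier are equal
  elements of the group.\<close>

definition Hom_group ::
    "('a, 'm) monoid_scheme \<Rightarrow> ('b, 'n) monoid_scheme \<Rightarrow> ('a \<Rightarrow> 'b) monoid" where
  "Hom_group M A =
     (product_group (carrier M) (\<lambda>_. A))\<lparr>carrier := hom M A \<inter> extensional (carrier M)\<rparr>"


section \<open>Second cohomology with trivial coefficients\<close>

text \<open>\<open>A\<close> is an abelian group, written multiplicatively, with trivial action of \<open>G\<close>.
  Cochains are extensional and need not be normalized.\<close>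

definition C2 ::
    "('g, 'm) monoid_scheme \<Rightarrow> ('b, 'n) monoid_scheme \<Rightarrow> ('g \<times> 'g \<Rightarrow> 'b) monoid" where
  "C2 G A = product_group (carrier G \<times> carrier G) (\<lambda>_. A)"

definition Z2 ::
    "('g, 'm) monoid_scheme \<Rightarrow> ('b, 'n) monoid_scheme \<Rightarrow> ('g \<times> 'g \<Rightarrow> 'b) set" where
  "Z2 G A = {\<alpha> \<in> carrier (C2 G A). \<forall>x\<in>carrier G. \<forall>y\<in>carrier G. \<forall>z\<in>carrier G.
     \<alpha> (y, z) \<otimes>\<^bsub>A\<^esub> \<alpha> (x, y \<otimes>\<^bsub>G\<^esub> z) = \<alpha> (x \<otimes>\<^bsub>G\<^esub> y, z) \<otimes>\<^bsub>A\<^esub> \<alpha> (x, y)}"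

definition B2 ::
    "('g, 'm) monoid_scheme \<Rightarrow> ('b, 'n) monoid_scheme \<Rightarrow> ('g \<times> 'g \<Rightarrow> 'b) set" where
  "B2 G A = {\<lambda>(x, y)\<in>carrier G \<times> carrier G. c x \<otimes>\<^bsub>A\<^esub> c y \<otimes>\<^bsub>A\<^esub> inv\<^bsub>A\<^esub> (c (x \<otimes>\<^bsub>G\<^esub> y)) | c.
     c \<in> carrier G \<rightarrow> carrier A}"

definition H2 ::
    "('g, 'm) monoid_scheme \<Rightarrow> ('b, 'n) monoid_scheme \<Rightarrow> ('g \<times> 'g \<Rightarrow> 'b) set monoid" where
  "H2 G A = (C2 G A)\<lparr>carrier := Z2 G A\<rparr> Mod B2 G A"

definition H2_class ::
    "('g, 'm) monoid_scheme \<Rightarrow> ('b, 'n) monoid_scheme \<Rightarrow> ('g \<times> 'g \<Rightarrow> 'b)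
      \<Rightarrow> ('g \<times> 'g \<Rightarrow> 'b) set" where
  "H2_class G A \<alpha> = B2 G A #>\<^bsub>C2 G A\<^esub> \<alpha>"

text \<open>Restriction to the subgroup \<open>S\<close>: all cocycles in a class \<open>\<xi>\<close> restrict to the same
  class, which \<open>the_elem\<close> picks out.\<close>

definition res2 ::
    "('g, 'm) monoid_scheme \<Rightarrow> ('b, 'n) monoid_scheme \<Rightarrow> 'g set
      \<Rightarrow> ('g \<times> 'g \<Rightarrow> 'b) set \<Rightarrow> ('g \<times> 'g \<Rightarrow> 'b) set" where
  "res2 G A S \<xi> = the_elem ((\<lambda>\<alpha>. H2_class (G\<lparr>carrier := S\<rparr>) A (restrict \<alpha> (S \<times> S))) ` \<xi>)"

definition Bogomolov_multiplier ::
    "('g, 'm) monoid_scheme \<Rightarrow> ('g \<times> 'g \<Rightarrow> rat set) set monoid" where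
  "Bogomolov_multiplier G = (H2 G QZ)\<lparr>carrier :=
     (\<Inter>S \<in> {S. subgroup S G \<and> comm_group (G\<lparr>carrier := S\<rparr>)}.
        kernel (H2 G QZ) (H2 (G\<lparr>carrier := S\<rparr>) QZ) (res2 G QZ S))\<rparr>"


section \<open>Transgression\<close>

definition is_section ::
    "('e, 'k) monoid_scheme \<Rightarrow> ('g, 'm) monoid_scheme \<Rightarrow> ('e \<Rightarrow> 'g) \<Rightarrow> ('g \<Rightarrow> 'e) \<Rightarrow> bool" where
  "is_section E G \<pi> \<mu> \<longleftrightarrow> \<mu> \<in> carrier G \<rightarrow> carrier E \<and> (\<forall>x\<in>carrier G. \<pi> (\<mu> x) = x)"

text \<open>For a central extension \<open>E\<close> of \<open>G\<close> with kernel \<open>M\<close> and section \<open>\<mu>\<close>, the argument of \<open>\<chi>\<close>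
  below lies in \<open>M\<close>.\<close>

definition transgression ::
    "('e, 'k) monoid_scheme \<Rightarrow> ('g, 'm) monoid_scheme \<Rightarrow> ('b, 'n) monoid_scheme
      \<Rightarrow> ('g \<Rightarrow> 'e) \<Rightarrow> ('e \<Rightarrow> 'b) \<Rightarrow> ('g \<times> 'g \<Rightarrow> 'b) set" where
  "transgression E G A \<mu> \<chi> = H2_class G A
     (\<lambda>(x, y)\<in>carrier G \<times> carrier G. \<chi> (\<mu> x \<otimes>\<^bsub>E\<^esub> \<mu> y \<otimes>\<^bsub>E\<^esub> inv\<^bsub>E\<^esub> (\<mu> (x \<otimes>\<^bsub>G\<^esub> y))))"

text \<open>The projection from \<open>F Mod N\<close> to \<open>F Mod R\<close> for \<open>N \<subseteq> R\<close>: the coset \<open>N x\<close> goes to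
  \<open>R N x = R x\<close>.\<close>

definition quotient_proj :: "('a, 'm) monoid_scheme \<Rightarrow> 'a set \<Rightarrow> 'a set \<Rightarrow> 'a set" where
  "quotient_proj F R C = R <#>\<^bsub>F\<^esub> C"

end

theory Submission
  imports Defs
begin

text \<open>
  Let \<open>\<pi>\<close> be the projection of \<open>F\<close> onto \<open>G\<close>. A cochain \<open>\<alpha>\<close> on \<open>G\<close> is handled through a map
  \<open>\<phi>\<close> on \<open>F\<close> with \<open>\<phi>(uv) = \<phi>(u) \<phi>(v) \<alpha>(\<pi> u, \<pi> v)\<close>. Its normalised restriction
  \<open>\<theta>(r) = \<phi>(r) / \<phi>(1)\<close> is a homomorphism on \<open>R\<close> that determines the class of \<open>\<alpha>\<close>, and \<open>\<alpha>\<close> is a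
  coboundary on a subgroup \<open>S\<close> of \<open>G\<close> iff \<open>\<theta>\<close> extends to a homomorphism on the preimage of \<open>S\<close>.

  As \<open>F\<close> is free, the projection lifts to the extension of \<open>G\<close> defined by \<open>\<alpha>\<close>, so every cocycle has
  such a \<open>\<phi>\<close>; a transgressed character \<open>\<chi>\<close> has one with \<open>\<theta> = \<chi>\<close>. Because \<open>\<rat>/\<int>\<close> is
  divisible, a homomorphism on a subgroup \<open>H\<close> of \<open>K\<close> extends to \<open>K\<close> iff it is trivial on
  \<open>H \<inter> K'\<close>. For \<open>S\<close> abelian the preimage has its derived subgroup inside \<open>\<langle>K(F) \<inter> R\<rangle>\<close>, hence the class
  of \<open>\<alpha>\<close> lies in \<open>B\<^sub>0(G)\<close> iff \<open>\<theta>\<close> kills \<open>K(F) \<inter> R\<close>, which gives surjectivity. Taking \<open>S = G\<close>, the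
  kernel of transgression consists of the characters trivial on \<open>F' \<inter> R\<close>, which is also the kernel of
  restriction to \<open>F' \<inter> R\<close>; restriction is surjective by the same extension property.
\<close>

section \<open>Extending homomorphisms into divisible groups\<close>

definition divisible_group :: "('a, 'm) monoid_scheme \<Rightarrow> bool" where
  "divisible_group D \<longleftrightarrow> comm_group D \<and>
     (\<forall>n>0. \<forall>x\<in>carrier D. \<exists>y\<in>carrier D. y [^]\<^bsub>D\<^esub> (n::nat) = x)"

section \<open>Divisibility of Q/Z\<close>

lemma comm_group_rat_group: "comm_group rat_group"
  by (rule comm_groupI) (auto simp: rat_group_def intro: exI[of _ "- x" for x])

lemma subgroup_Ints_rat_group: "subgroup \<int> rat_group"
proof -
  interpret comm_group rat_group by (rule comm_group_rat_group)
  have "inv\<^bsub>rat_group\<^esub> x = - x" for x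
    by (rule inv_equality) (auto simp: rat_group_def)
  then show ?thesis
    by (intro subgroupI) (auto simp: rat_group_def)
qed

text \<open>A coset is divided by \<open>n\<close> by dividing a rational representative. After this
  lemma \<open>QZ\<close> is never unfolded: only commutativity and divisibility are used.\<close>

lemma divisible_QZ: "divisible_group QZ"
  unfolding divisible_group_def
proof (intro conjI allI impI ballI)
  interpret comm_group rat_group by (rule comm_group_rat_group)
  show "comm_group QZ"
    unfolding QZ_def by (rule abelian_FactGroup[OF subgroup_Ints_rat_group])
next
  interpret comm_group rat_group by (rule comm_group_rat_group)
  interpret N: normal \<int> rat_group
    using subgroup_Ints_rat_group by (rule subgroup_imp_normal)
  fix n :: nat and W
  assume "0 < n" and "W \<in> carrier QZ"
  then obtain x where W: "W = \<int> #>\<^bsub>rat_group\<^esub> x"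
    by (auto simp: QZ_def carrier_FactGroup)
  have pow: "y [^]\<^bsub>rat_group\<^esub> (m::nat) = of_nat m * y" for y m
    by (induction m) (auto simp: rat_group_def algebra_simps)
  define y where "y = x / of_nat n"
  have y: "y \<in> carrier rat_group" by (simp add: rat_group_def)
  have "y [^]\<^bsub>rat_group\<^esub> n = x" using \<open>0 < n\<close> by (simp add: pow y_def)
  then have "(\<int> #>\<^bsub>rat_group\<^esub> y) [^]\<^bsub>QZ\<^esub> n = W"
    unfolding QZ_def W by (simp add: N.FactGroup_pow[OF y])
  moreover have "\<int> #>\<^bsub>rat_group\<^esub> y \<in> carrier QZ"
    using y by (auto simp: QZ_def carrier_FactGroup)
  ultimately show "\<exists>Y\<in>carrier QZ. Y [^]\<^bsub>QZ\<^esub> n = W" by blast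
qed

section \<open>Extension of homomorphisms by Zorn's lemma\<close>

lemma (in group) subgroup_Union_chain:
  assumes "\<C> \<noteq> {}" and "subset.chain {H. subgroup H G} \<C>"
  shows "subgroup (\<Union>\<C>) G"
proof -
  have sub: "subgroup H G" if "H \<in> \<C>" for H
    using assms(2) that by (auto simp: subset.chain_def)
  \<comment> \<open>A chain is totally ordered by inclusion, so two elements of the union share a
    member, from which closure is inherited.\<close>
  have "\<exists>H\<in>\<C>. x \<in> H \<and> y \<in> H" if "x \<in> \<Union>\<C>" "y \<in> \<Union>\<C>" for x y
    using assms(2) that unfolding subset_chain_def by (metis UnionE subsetD)
  then have "x \<otimes> y \<in> \<Union>\<C>" if "x \<in> \<Union>\<C>" "y \<in> \<Union>\<C>" for x y
    using that sub subgroup.m_closed by (metis UnionI)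
  moreover have "\<Union>\<C> \<subseteq> carrier G" using sub subgroup.subset by blast
  moreover have "\<Union>\<C> \<noteq> {}" using assms(1) sub subgroup.one_closed by blast
  moreover have "inv x \<in> \<Union>\<C>" if "x \<in> \<Union>\<C>" for x
    using that sub subgroup.m_inv_closed by (metis UnionE UnionI)
  ultimately show ?thesis by (intro subgroupI)
qed

lemma int_pow_DirProd:
  assumes "group K" "group D" "k \<in> carrier K" "a \<in> carrier D"
  shows "(k, a) [^]\<^bsub>K \<times>\<times> D\<^esub> (i::int) = (k [^]\<^bsub>K\<^esub> i, a [^]\<^bsub>D\<^esub> i)"
proof -
  interpret P: group "K \<times>\<times> D" using assms by (simp add: DirProd_group)
  have "fst \<in> hom (K \<times>\<times> D) K" "snd \<in> hom (K \<times>\<times> D) D"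
    by (auto simp: hom_def mult_DirProd')
  then show ?thesis
    using hom_int_pow[of fst "K \<times>\<times> D" K "(k, a)" i] hom_int_pow[of snd "K \<times>\<times> D" D "(k, a)" i] assms
    by (simp add: prod_eq_iff P.is_group)
qed

text \<open>Homomorphisms from subgroups of \<open>K\<close> to \<open>D\<close> are encoded by their graphs: subgroups of
  \<open>K \<times> D\<close> that meet \<open>1 \<times> D\<close> trivially. Containing \<open>K' \<times> 1\<close> makes a graph normal.\<close>

lemma normal_of_derived_le:
  assumes "group K" "comm_group D" "subgroup \<Gamma> (K \<times>\<times> D)"
    and "derived K (carrier K) \<times> {\<one>\<^bsub>D\<^esub>} \<subseteq> \<Gamma>"
  shows "\<Gamma> \<lhd> K \<times>\<times> D"
proof -
  interpret K: group K by fact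
  interpret D: comm_group D by fact
  interpret P: group "K \<times>\<times> D" by (simp add: DirProd_group K.is_group D.is_group)
  interpret \<Gamma>: subgroup \<Gamma> "K \<times>\<times> D" by fact
  show ?thesis
  proof (rule P.normal_invI[OF assms(3)])
    fix p q assume p: "p \<in> carrier (K \<times>\<times> D)" and q: "q \<in> \<Gamma>"
    obtain k a g d where pq: "p = (k, a)" "q = (g, d)" by fastforce
    have c: "k \<in> carrier K" "a \<in> carrier D" "g \<in> carrier K" "d \<in> carrier D"
      using p \<Gamma>.mem_carrier[OF q] by (auto simp: pq)
    \<comment> \<open>Since \<open>D\<close> is commutative, conjugation by \<open>p\<close> changes
      \<open>q\<close> only by the factor \<open>(?c, 1)\<close>, which lies in \<Gamma> by
      assumption.\<close>
    let ?c = "k \<otimes>\<^bsub>K\<^esub> g \<otimes>\<^bsub>K\<^esub> inv\<^bsub>K\<^esub> k \<otimes>\<^bsub>K\<^esub> inv\<^bsub>K\<^esub> g"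
    have "?c \<in> derived K (carrier K)"
      unfolding derived_def using c by (intro generate.incl) blast
    then have "(?c, \<one>\<^bsub>D\<^esub>) \<in> \<Gamma>" using assms(4) by blast
    then have "(?c, \<one>\<^bsub>D\<^esub>) \<otimes>\<^bsub>K \<times>\<times> D\<^esub> (g, d) \<in> \<Gamma>"
      using q unfolding pq by (rule \<Gamma>.m_closed)
    moreover have "?c \<otimes>\<^bsub>K\<^esub> g = k \<otimes>\<^bsub>K\<^esub> g \<otimes>\<^bsub>K\<^esub> inv\<^bsub>K\<^esub> k" using c by (simp add: K.m_assoc)
    moreover have "a \<otimes>\<^bsub>D\<^esub> d \<otimes>\<^bsub>D\<^esub> inv\<^bsub>D\<^esub> a = d"
      using c by (metis D.inv_solve_right' D.m_comm D.m_closed)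
    ultimately show "p \<otimes>\<^bsub>K \<times>\<times> D\<^esub> q \<otimes>\<^bsub>K \<times>\<times> D\<^esub> inv\<^bsub>K \<times>\<times> D\<^esub> p \<in> \<Gamma>"
      using c by (simp add: pq inv_DirProd K.is_group D.is_group)
  qed
qed

text \<open>The value \<open>a\<close> that an extension of the graph may take at \<open>k\<close>.
  If no nonzero power of \<open>k\<close> lies in the domain of \<Gamma>, there is no constraint and
  \<open>a\<close> is chosen as 1. Otherwise let \<open>n\<close> be the least positive exponent
  with \<open>k^n\<close> in the domain and \<open>a\<close> an \<open>n\<close>-th root of the
  value there. Divisibility of \<open>D\<close> provides this root.\<close>

lemma graph_step_value:
  assumes "group K" and D: "divisible_group D" and sub: "subgroup \<Gamma> (K \<times>\<times> D)"
    and triv: "\<And>d. (\<one>\<^bsub>K\<^esub>, d) \<in> \<Gamma> \<Longrightarrow> d = \<one>\<^bsub>D\<^esub>" and k: "k \<in> carrier K"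
  obtains a where "a \<in> carrier D" "\<And>i::int. \<And>d. (k [^]\<^bsub>K\<^esub> i, d) \<in> \<Gamma> \<Longrightarrow> d = a [^]\<^bsub>D\<^esub> i"
proof -
  interpret K: group K by fact
  interpret D: comm_group D using D by (simp add: divisible_group_def)
  interpret P: group "K \<times>\<times> D" by (simp add: DirProd_group K.is_group D.is_group)
  interpret \<Gamma>: subgroup \<Gamma> "K \<times>\<times> D" by fact
  define J where "J = {n::nat. 0 < n \<and> (\<exists>d. (k [^]\<^bsub>K\<^esub> n, d) \<in> \<Gamma>)}"
  \<comment> \<open>Inversion in \<Gamma> turns negative exponents into positive ones, so
    \<open>J\<close>, which records only positive ones, still detects every nonzero exponent in the
    domain.\<close>
  have pos: "nat \<bar>i\<bar> \<in> J" if "(k [^]\<^bsub>K\<^esub> i, d) \<in> \<Gamma>" "i \<noteq> 0" for i :: int and d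
  proof -
    have "d \<in> carrier D" using \<Gamma>.mem_carrier[OF that(1)] by simp
    then have "(k [^]\<^bsub>K\<^esub> (-i), inv\<^bsub>D\<^esub> d) \<in> \<Gamma>"
      using \<Gamma>.m_inv_closed[OF that(1)] k by (simp add: K.int_pow_neg K.is_group D.is_group)
    then show ?thesis
      using that by (cases "i \<ge> 0") (auto simp: J_def simp flip: int_pow_int)
  qed
  show thesis
  proof (cases "J = {}")
    case True
    show thesis
    proof (rule that[of "\<one>\<^bsub>D\<^esub>"])
      fix i :: int and d assume "(k [^]\<^bsub>K\<^esub> i, d) \<in> \<Gamma>"
      then show "d = \<one>\<^bsub>D\<^esub> [^]\<^bsub>D\<^esub> i" using pos True triv by (cases "i = 0") auto
    qed simp
  next
    case False
    define n where "n = (LEAST n. n \<in> J)"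
    have n: "n \<in> J" using False unfolding n_def by (metis LeastI ex_in_conv)
    then obtain e where e: "(k [^]\<^bsub>K\<^esub> n, e) \<in> \<Gamma>" and n0: "0 < n" by (auto simp: J_def)
    have ec: "e \<in> carrier D" using \<Gamma>.mem_carrier[OF e] by simp
    obtain a where a: "a \<in> carrier D" "a [^]\<^bsub>D\<^esub> n = e"
      using D n0 ec unfolding divisible_group_def by blast
    show thesis
    proof (rule that[OF a(1)])
      fix i :: int and d assume i: "(k [^]\<^bsub>K\<^esub> i, d) \<in> \<Gamma>"
      have dc: "d \<in> carrier D" using \<Gamma>.mem_carrier[OF i] by simp
      \<comment> \<open>Division with remainder: removing the multiple of \<open>n\<close> leaves
        \<open>k^r\<close> in the domain with 0 \<le> r < n. Minimality of \<open>n\<close> forces r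
        = 0, and then triviality over the identity compares \<open>d\<close> with the power of
        \<open>a\<close>.\<close>
      define q r where "q = i div int n" and "r = i mod int n"
      have iqr: "i = int n * q + r" by (simp add: q_def r_def)
      have "(k [^]\<^bsub>K\<^esub> n, e) [^]\<^bsub>K \<times>\<times> D\<^esub> (- q) \<in> \<Gamma>"
        by (rule P.subgroup_int_pow_closed[OF sub e])
      moreover have "(k [^]\<^bsub>K\<^esub> n, e) [^]\<^bsub>K \<times>\<times> D\<^esub> (- q) = (k [^]\<^bsub>K\<^esub> (- (int n * q)), a [^]\<^bsub>D\<^esub> (- (int n * q)))"
        using k a by (simp add: int_pow_DirProd K.is_group D.is_group K.int_pow_pow D.int_pow_pow flip: int_pow_int a(2))
      ultimately have "(k [^]\<^bsub>K\<^esub> i, d) \<otimes>\<^bsub>K \<times>\<times> D\<^esub> (k [^]\<^bsub>K\<^esub> (- (int n * q)), a [^]\<^bsub>D\<^esub> (- (int n * q))) \<in> \<Gamma>"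
        using i by (metis \<Gamma>.m_closed)
      moreover have "k [^]\<^bsub>K\<^esub> i \<otimes>\<^bsub>K\<^esub> k [^]\<^bsub>K\<^esub> (- (int n * q)) = k [^]\<^bsub>K\<^esub> r"
        using k by (simp add: iqr flip: K.int_pow_mult)
      ultimately have r: "(k [^]\<^bsub>K\<^esub> r, d \<otimes>\<^bsub>D\<^esub> a [^]\<^bsub>D\<^esub> (- (int n * q))) \<in> \<Gamma>" by simp
      have "r = 0"
      proof (rule ccontr)
        assume "r \<noteq> 0"
        with pos[OF r] have "n \<le> nat \<bar>r\<bar>" unfolding n_def by (metis Least_le)
        then show False using n0 unfolding r_def
          by (metis abs_of_nonneg nat_le_iff not_le of_nat_0_less_iff pos_mod_bound pos_mod_sign zle_int int_nat_eq of_nat_nat)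
      qed
      then have "d \<otimes>\<^bsub>D\<^esub> a [^]\<^bsub>D\<^esub> (- i) = \<one>\<^bsub>D\<^esub>" using r triv iqr by simp
      then show "d = a [^]\<^bsub>D\<^esub> i"
        using dc a by (metis D.int_pow_closed D.int_pow_neg D.inv_equality D.inv_inv D.inv_closed)
    qed
  qed
qed

text \<open>Zorn's lemma yields a maximal graph above \<open>\<Gamma>0\<close> that is trivial over
  1. For any \<open>k\<close>, adjoining \<open>(k, a)\<close> with \<open>a\<close> from
  \<open>graph_step_value\<close> gives another such graph, so by maximality \<open>(k, a)\<close>
  was already there and the domain is all of \<open>K\<close>.\<close>

lemma graph_extension:
  assumes "group K" and D: "divisible_group D" and sub: "subgroup \<Gamma>0 (K \<times>\<times> D)"
    and der: "derived K (carrier K) \<times> {\<one>\<^bsub>D\<^esub>} \<subseteq> \<Gamma>0"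
    and triv: "\<And>d. (\<one>\<^bsub>K\<^esub>, d) \<in> \<Gamma>0 \<Longrightarrow> d = \<one>\<^bsub>D\<^esub>"
  obtains \<Gamma> where "subgroup \<Gamma> (K \<times>\<times> D)" "\<Gamma>0 \<subseteq> \<Gamma>" "fst ` \<Gamma> = carrier K"
    "\<And>d. (\<one>\<^bsub>K\<^esub>, d) \<in> \<Gamma> \<Longrightarrow> d = \<one>\<^bsub>D\<^esub>"
proof -
  interpret K: group K by fact
  interpret D: comm_group D using D by (simp add: divisible_group_def)
  interpret P: group "K \<times>\<times> D" by (simp add: DirProd_group K.is_group D.is_group)
  define \<A> where "\<A> = {\<Gamma>. subgroup \<Gamma> (K \<times>\<times> D) \<and> \<Gamma>0 \<subseteq> \<Gamma> \<and> (\<forall>d. (\<one>\<^bsub>K\<^esub>, d) \<in> \<Gamma> \<longrightarrow> d = \<one>\<^bsub>D\<^esub>)}"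
  have "\<exists>M\<in>\<A>. \<forall>W\<in>\<A>. M \<subseteq> W \<longrightarrow> W = M"
  proof (rule subset_Zorn_nonempty)
    show "\<A> \<noteq> {}" using sub triv by (auto simp: \<A>_def)
    fix \<C> assume C: "\<C> \<noteq> {}" "subset.chain \<A> \<C>"
    then have "subset.chain {H. subgroup H (K \<times>\<times> D)} \<C>"
      by (auto simp: subset.chain_def \<A>_def)
    then have "subgroup (\<Union>\<C>) (K \<times>\<times> D)" by (rule P.subgroup_Union_chain[OF C(1)])
    moreover have "\<C> \<subseteq> \<A>" using C(2) by (simp add: subset.chain_def)
    ultimately show "\<Union>\<C> \<in> \<A>" using C(1) unfolding \<A>_def by blast
  qed
  then obtain \<Gamma> where G: "\<Gamma> \<in> \<A>" and max: "\<And>W. W \<in> \<A> \<Longrightarrow> \<Gamma> \<subseteq> W \<Longrightarrow> W = \<Gamma>" by blast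
  interpret \<Gamma>: subgroup \<Gamma> "K \<times>\<times> D" using G by (simp add: \<A>_def)
  have triv': "d = \<one>\<^bsub>D\<^esub>" if "(\<one>\<^bsub>K\<^esub>, d) \<in> \<Gamma>" for d using G that by (simp add: \<A>_def)
  have sup: "\<Gamma>0 \<subseteq> \<Gamma>" using G by (simp add: \<A>_def)
  have "k \<in> fst ` \<Gamma>" if k: "k \<in> carrier K" for k
  proof -
    obtain a where a: "a \<in> carrier D" and av: "\<And>i::int. \<And>d. (k [^]\<^bsub>K\<^esub> i, d) \<in> \<Gamma> \<Longrightarrow> d = a [^]\<^bsub>D\<^esub> i"
      using graph_step_value[OF assms(1) D \<Gamma>.subgroup_axioms triv' k] by blast
    have ka: "(k, a) \<in> carrier (K \<times>\<times> D)" using k a by simp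
    let ?E = "generate (K \<times>\<times> D) {(k, a)}"
    have E: "subgroup ?E (K \<times>\<times> D)" using ka by (intro P.generate_is_subgroup) auto
    \<comment> \<open>The product with the cyclic group generated by \<open>(k, a)\<close> is a
      subgroup because \<Gamma>, containing K' x 1, is normal.\<close>
    define C where "C = \<Gamma> <#>\<^bsub>K \<times>\<times> D\<^esub> ?E"
    have "\<Gamma> \<lhd> K \<times>\<times> D"
      using sup der by (intro normal_of_derived_le[OF assms(1) D.comm_group_axioms \<Gamma>.subgroup_axioms]) blast
    then have C: "subgroup C (K \<times>\<times> D)" unfolding C_def by (rule P.mult_norm_subgroup[OF _ E])
    have GC: "\<Gamma> \<subseteq> C"
    proof
      fix x assume x: "x \<in> \<Gamma>"
      then have "x \<otimes>\<^bsub>K \<times>\<times> D\<^esub> \<one>\<^bsub>K \<times>\<times> D\<^esub> \<in> C"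
        unfolding C_def set_mult_def using generate.one by blast
      then show "x \<in> C" using \<Gamma>.mem_carrier[OF x] by (simp only: P.r_one)
    qed
    \<comment> \<open>An element of \<open>C\<close> over 1 is \<open>(g, d)\<close> times the
      \<open>i\<close>-th power of \<open>(k, a)\<close>, so \<open>g\<close> is the power of
      \<open>k\<close> with exponent \<open>-i\<close>. The choice of \<open>a\<close> then makes
      \<open>d\<close> the matching power of \<open>a\<close>, and the factors cancel.\<close>
    have "x = \<one>\<^bsub>D\<^esub>" if x: "(\<one>\<^bsub>K\<^esub>, x) \<in> C" for x
    proof -
      obtain p q where pq: "p \<in> \<Gamma>" "q \<in> ?E" "(\<one>\<^bsub>K\<^esub>, x) = p \<otimes>\<^bsub>K \<times>\<times> D\<^esub> q"
        using x unfolding C_def set_mult_def by blast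
      obtain i :: int where "q = (k, a) [^]\<^bsub>K \<times>\<times> D\<^esub> i"
        using pq(2) P.generate_pow[OF ka] by blast
      then have q: "q = (k [^]\<^bsub>K\<^esub> i, a [^]\<^bsub>D\<^esub> i)"
        using int_pow_DirProd[OF K.is_group D.is_group k a] by simp
      obtain g d where p: "p = (g, d)" by fastforce
      have gd: "g \<in> carrier K" "d \<in> carrier D" using \<Gamma>.mem_carrier[OF pq(1)] by (auto simp: p)
      have "g \<otimes>\<^bsub>K\<^esub> k [^]\<^bsub>K\<^esub> i = \<one>\<^bsub>K\<^esub>" and x: "x = d \<otimes>\<^bsub>D\<^esub> a [^]\<^bsub>D\<^esub> i"
        using pq(3) by (auto simp: p q)
      then have "g = k [^]\<^bsub>K\<^esub> (- i)" using gd k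
        by (metis K.int_pow_closed K.int_pow_neg K.inv_equality K.inv_inv K.inv_closed)
      then have "d = a [^]\<^bsub>D\<^esub> (- i)" using pq(1) p av by blast
      then show ?thesis using a x by (simp add: D.int_pow_neg)
    qed
    then have "C \<in> \<A>" using C GC sup unfolding \<A>_def by blast
    then have "C = \<Gamma>" using GC max by blast
    moreover have "\<one>\<^bsub>K \<times>\<times> D\<^esub> \<otimes>\<^bsub>K \<times>\<times> D\<^esub> (k, a) \<in> C"
      unfolding C_def set_mult_def using generate.incl[of "(k,a)" "{(k,a)}"] \<Gamma>.one_closed by blast
    ultimately have "(k, a) \<in> \<Gamma>" using ka by (simp only: P.l_one)
    then show ?thesis by force
  qed
  moreover have "fst ` \<Gamma> \<subseteq> carrier K" using \<Gamma>.subset by auto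
  ultimately show thesis using that[OF \<Gamma>.subgroup_axioms sup _ triv'] by blast
qed

text \<open>The graph of \<chi> is enlarged by K' x 1. Triviality of \<chi> on the intersection of
  \<open>H\<close> with K' is what keeps the enlarged graph single-valued, and a total single-valued
  graph above it is the graph of the extension.\<close>

lemma hom_extension:
  assumes "group K" and D: "divisible_group D" and H: "subgroup H K"
    and \<chi>: "\<chi> \<in> hom (K\<lparr>carrier := H\<rparr>) D"
    and triv: "\<And>h. h \<in> H \<Longrightarrow> h \<in> derived K (carrier K) \<Longrightarrow> \<chi> h = \<one>\<^bsub>D\<^esub>"
  obtains \<psi> where "\<psi> \<in> hom K D" "\<And>h. h \<in> H \<Longrightarrow> \<psi> h = \<chi> h"
proof -
  interpret K: group K by fact
  interpret D: comm_group D using D by (simp add: divisible_group_def)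
  interpret P: group "K \<times>\<times> D" by (simp add: DirProd_group K.is_group D.is_group)
  interpret H: subgroup H K by fact
  interpret \<chi>: group_hom "K\<lparr>carrier := H\<rparr>" D \<chi>
    using \<chi> by (simp add: group_hom_def group_hom_axioms_def D.is_group K.subgroup_imp_group[OF H])
  let ?K' = "derived K (carrier K)"
  have K': "?K' \<lhd> K" by (rule K.derived_self_is_normal)
  have K'1: "?K' \<times> {\<one>\<^bsub>D\<^esub>} \<lhd> K \<times>\<times> D"
    using K.DirProd_normal[OF D.is_group K' D.one_is_normal] .
  define graph where "graph = (\<lambda>h. (h, \<chi> h)) ` H"
  have cl: "\<chi> h \<in> carrier D" if "h \<in> H" for h using \<chi>.hom_closed that by simp
  have graph: "subgroup graph (K \<times>\<times> D)"
  proof (rule P.subgroupI)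
    show "graph \<subseteq> carrier (K \<times>\<times> D)" using H.subset cl by (auto simp: graph_def)
    show "graph \<noteq> {}" using H.one_closed by (auto simp: graph_def simp del: H.one_closed)
    show "inv\<^bsub>K \<times>\<times> D\<^esub> p \<in> graph" if "p \<in> graph" for p
    proof -
      from that obtain h where h: "h \<in> H" "p = (h, \<chi> h)" by (auto simp: graph_def)
      then have "\<chi> (inv\<^bsub>K\<^esub> h) = inv\<^bsub>D\<^esub> (\<chi> h)"
        using \<chi>.hom_inv[of h] K.m_inv_consistent[OF H h(1)] by simp
      then show ?thesis using h cl H.mem_carrier
        by (auto simp: graph_def K.is_group D.is_group image_iff)
    qed
    show "p \<otimes>\<^bsub>K \<times>\<times> D\<^esub> q \<in> graph" if "p \<in> graph" "q \<in> graph" for p q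
      using that \<chi>.hom_mult by (auto simp: graph_def image_iff)
  qed
  \<comment> \<open>Every homomorphism from \<open>K\<close> to the commutative group
    \<open>D\<close> is trivial on K', so the pairs \<open>(c, 1)\<close> with \<open>c\<close> in
    K' must belong to any extension.\<close>
  define \<Gamma>0 where "\<Gamma>0 = (?K' \<times> {\<one>\<^bsub>D\<^esub>}) <#>\<^bsub>K \<times>\<times> D\<^esub> graph"
  have mem: "p \<in> \<Gamma>0 \<longleftrightarrow> (\<exists>c\<in>?K'. \<exists>h\<in>H. p = (c \<otimes>\<^bsub>K\<^esub> h, \<chi> h))" for p
    using cl by (auto simp: \<Gamma>0_def set_mult_def graph_def)
  have G0: "subgroup \<Gamma>0 (K \<times>\<times> D)"
    unfolding \<Gamma>0_def by (rule P.mult_norm_subgroup[OF K'1 graph])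
  have K'sub: "subgroup ?K' K" using K' by (rule normal_imp_subgroup)
  have der: "?K' \<times> {\<one>\<^bsub>D\<^esub>} \<subseteq> \<Gamma>0"
  proof
    fix p assume "p \<in> ?K' \<times> {\<one>\<^bsub>D\<^esub>}"
    then obtain c where c: "c \<in> ?K'" "p = (c, \<one>\<^bsub>D\<^esub>)" by auto
    then have "p = (c \<otimes>\<^bsub>K\<^esub> \<one>\<^bsub>K\<^esub>, \<chi> \<one>\<^bsub>K\<^esub>)"
      using \<chi>.hom_one subgroup.mem_carrier[OF K'sub c(1)] by simp
    then show "p \<in> \<Gamma>0" using c(1) H.one_closed unfolding mem by blast
  qed
  \<comment> \<open>A point over 1 comes from \<open>c\<close> in K' and \<open>h\<close> in
    \<open>H\<close> with \<open>h\<close> the inverse of \<open>c\<close>, so \<open>h\<close> lies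
    in both groups and \<chi> vanishes there.\<close>
  have tr: "d = \<one>\<^bsub>D\<^esub>" if one: "(\<one>\<^bsub>K\<^esub>, d) \<in> \<Gamma>0" for d
  proof -
    obtain c h where ch: "c \<in> ?K'" "h \<in> H" "\<one>\<^bsub>K\<^esub> = c \<otimes>\<^bsub>K\<^esub> h" "d = \<chi> h"
      using one unfolding mem by blast
    have "h = inv\<^bsub>K\<^esub> c" using ch subgroup.mem_carrier[OF K'sub ch(1)] H.mem_carrier
      by (metis K.inv_equality K.inv_inv K.inv_closed)
    then have "h \<in> ?K'" using ch(1) subgroup.m_inv_closed[OF K'sub] by simp
    then show ?thesis using triv ch by simp
  qed
  obtain \<Gamma> where G: "subgroup \<Gamma> (K \<times>\<times> D)" and sup: "\<Gamma>0 \<subseteq> \<Gamma>" and onto: "fst ` \<Gamma> = carrier K"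
    and triv\<Gamma>: "\<And>d. (\<one>\<^bsub>K\<^esub>, d) \<in> \<Gamma> \<Longrightarrow> d = \<one>\<^bsub>D\<^esub>"
    using graph_extension[OF assms(1) D G0 der tr] by blast
  interpret \<Gamma>: subgroup \<Gamma> "K \<times>\<times> D" by (rule G)
  have uniq: "d = d'" if "(k, d) \<in> \<Gamma>" "(k, d') \<in> \<Gamma>" for k d d'
  proof -
    have c: "k \<in> carrier K" "d \<in> carrier D" "d' \<in> carrier D"
      using that \<Gamma>.mem_carrier by auto
    have "(k, d) \<otimes>\<^bsub>K \<times>\<times> D\<^esub> inv\<^bsub>K \<times>\<times> D\<^esub> (k, d') \<in> \<Gamma>" using that by blast
    then have "d \<otimes>\<^bsub>D\<^esub> inv\<^bsub>D\<^esub> d' = \<one>\<^bsub>D\<^esub>" using c triv\<Gamma> by (simp add: K.is_group D.is_group)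
    then show ?thesis using c by (metis D.inv_equality D.inv_inv D.inv_closed)
  qed
  define \<psi> where "\<psi> k = (THE d. (k, d) \<in> \<Gamma>)" for k
  have \<psi>I: "\<psi> k = d" if "(k, d) \<in> \<Gamma>" for k d
    unfolding \<psi>_def using that uniq by blast
  have \<psi>: "(k, \<psi> k) \<in> \<Gamma>" if k: "k \<in> carrier K" for k
  proof -
    obtain d where "(k, d) \<in> \<Gamma>" using k onto by force
    then show ?thesis using \<psi>I by blast
  qed
  show thesis
  proof (rule that[of \<psi>])
    show "\<psi> \<in> hom K D"
    proof (rule homI)
      show "\<psi> k \<in> carrier D" if "k \<in> carrier K" for k
        using \<Gamma>.mem_carrier[OF \<psi>[OF that]] by simp
      show "\<psi> (k \<otimes>\<^bsub>K\<^esub> l) = \<psi> k \<otimes>\<^bsub>D\<^esub> \<psi> l" if "k \<in> carrier K" "l \<in> carrier K" for k l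
        using \<Gamma>.m_closed[OF \<psi>[OF that(1)] \<psi>[OF that(2)]] by (intro \<psi>I) simp
    qed
    show "\<psi> h = \<chi> h" if h: "h \<in> H" for h
    proof -
      have "(\<one>\<^bsub>K\<^esub> \<otimes>\<^bsub>K\<^esub> h, \<chi> h) \<in> \<Gamma>0" unfolding mem using h subgroup.one_closed[OF K'sub] by blast
      then show ?thesis using h H.mem_carrier sup by (intro \<psi>I) auto
    qed
  qed
qed

section \<open>Free groups and trivialized cocycles\<close>

abbreviation map_word :: "('a \<Rightarrow> 'b) \<Rightarrow> ('a \<times> bool) list \<Rightarrow> ('b \<times> bool) list" where
  "map_word f \<equiv> map (apfst f)"

lemma reduced_words_alt:
  "reduced_words S = {w. set w \<subseteq> S \<times> UNIV \<and>
     successively (\<lambda>(x, b) (y, c). \<not> (x = y \<and> b \<noteq> c)) w}"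
  by (auto simp: reduced_words_def lists_eq_set)

lemma word_val_Nil [simp]: "word_val F [] = \<one>\<^bsub>F\<^esub>"
  by (simp add: word_val_def)

lemma word_val_Cons [simp]:
  "word_val F ((x, b) # w) = (if b then x else inv\<^bsub>F\<^esub> x) \<otimes>\<^bsub>F\<^esub> word_val F w"
  by (simp add: word_val_def)

lemma (in group) word_val_closed [intro]: "set w \<subseteq> (carrier G \<times> UNIV) \<Longrightarrow> word_val G w \<in> carrier G"
  by (induction w) auto

lemma (in group) word_val_append:
  "set v \<subseteq> (carrier G \<times> UNIV) \<Longrightarrow> set w \<subseteq> (carrier G \<times> UNIV) \<Longrightarrow>
    word_val G (v @ w) = word_val G v \<otimes> word_val G w"
  by (induction v) (auto simp: m_assoc word_val_closed)

lemma (in group) word_val_cancel: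
  assumes "x \<in> carrier G" "set w \<subseteq> (carrier G \<times> UNIV)" "b \<noteq> c"
  shows "word_val G ((x, b) # (x, c) # w) = word_val G w"
  using assms word_val_closed[OF assms(2)] by (cases b; cases c) (auto simp flip: m_assoc)

lemma set_map_word_subset: "f \<in> S \<rightarrow> T \<Longrightarrow> set w \<subseteq> (S \<times> UNIV) \<Longrightarrow> set (map_word f w) \<subseteq> (T \<times> UNIV)"
  by (induction w) auto

lemma (in group_hom) hom_word_val:
  "set w \<subseteq> (carrier G \<times> UNIV) \<Longrightarrow> h (word_val G w) = word_val H (map_word h w)"
  by (induction w) (auto simp: G.word_val_closed)

text \<open>Cancelling adjacent inverse letters changes neither the value in \<open>F\<close> nor
  the value of the image word in \<open>E\<close>, so a word can be reduced with both values
  kept.\<close>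

lemma reduced_word_same_values:
  assumes "group F" "group E" "S \<subseteq> carrier F" "f \<in> S \<rightarrow> carrier E" "set w \<subseteq> (S \<times> UNIV)"
  shows "\<exists>v\<in>reduced_words S. word_val F v = word_val F w \<and>
           word_val E (map_word f v) = word_val E (map_word f w)"
  using assms(5)
proof (induction w)
  case Nil
  have "[] \<in> reduced_words S" by (simp add: reduced_words_alt)
  then show ?case by (intro bexI[of _ "[]"]) auto
next
  case (Cons l w)
  obtain x b where l: "l = (x, b)" by fastforce
  have x: "x \<in> S" using Cons.prems l by simp
  obtain v where v: "v \<in> reduced_words S" "word_val F v = word_val F w"
    "word_val E (map_word f v) = word_val E (map_word f w)"
    using Cons.IH Cons.prems by (meson set_subset_Cons subset_trans)
  show ?case
  \<comment> \<open>With \<open>v\<close> reduced, only the junction between the new letter and the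
    head of \<open>v\<close> can fail to be reduced.\<close>
  proof (cases "\<exists>c u. v = (x, c) # u \<and> b \<noteq> c")
    case True
    then obtain c u where u: "v = (x, c) # u" "b \<noteq> c" by blast
    have "u \<in> reduced_words S"
      using v(1) by (auto simp: u reduced_words_alt successively_Cons)
    moreover from this have lu: "set u \<subseteq> (S \<times> UNIV)" by (simp add: reduced_words_alt)
    have "word_val F (l # v) = word_val F u"
      using group.word_val_cancel[OF assms(1) subsetD[OF assms(3) x] _ u(2), of u] lu assms(3)
      unfolding l u by blast
    moreover have "word_val E (map_word f (l # v)) = word_val E (map_word f u)"
      using group.word_val_cancel[OF assms(2) _ _ u(2), of "f x" "map_word f u"]
        set_map_word_subset[OF assms(4) lu] funcset_mem[OF assms(4) x]
      by (simp add: l u del: word_val_Cons)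
    ultimately show ?thesis using v(2,3) by (intro bexI[of _ u]) (auto simp: l)
  next
    case False
    then have "l # v \<in> reduced_words S"
      using v(1) x by (cases v) (auto simp: reduced_words_alt l)
    then show ?thesis using v(2,3) by (intro bexI[of _ "l # v"]) (auto simp: l)
  qed
qed

text \<open>The homomorphism evaluates in \<open>E\<close> the image of the unique reduced word of
  an element.\<close>

lemma free_basis_hom_exists:
  assumes "group F" "free_basis F S" "group E" "f \<in> S \<rightarrow> carrier E"
  obtains h where "h \<in> hom F E" "\<And>s. s \<in> S \<Longrightarrow> h s = f s"
proof -
  interpret F: group F by fact
  interpret E: group E by fact
  have S: "S \<subseteq> carrier F" and bij: "bij_betw (word_val F) (reduced_words S) (carrier F)"
    using assms(2) by (auto simp: free_basis_def)
  define word where "word = the_inv_into (reduced_words S) (word_val F)"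
  define h where "h u = word_val E (map_word f (word u))" for u
  have word: "word u \<in> reduced_words S" "word_val F (word u) = u" if "u \<in> carrier F" for u
    using that bij unfolding word_def
    by (auto simp: bij_betw_def the_inv_into_into f_the_inv_into_f)
  have wl: "set (word u) \<subseteq> (S \<times> UNIV)" if "u \<in> carrier F" for u
    using word(1)[OF that] by (simp add: reduced_words_alt)
  have lF: "set w \<subseteq> (carrier F \<times> UNIV)" if "set w \<subseteq> (S \<times> UNIV)" for w :: "('a \<times> bool) list"
    using that S by blast
  \<comment> \<open>Any word for an element may be used, not just the reduced one. Concatenated
    reduced words, which need not be reduced, therefore compute products.\<close>
  have h: "h (word_val F w) = word_val E (map_word f w)" if w: "set w \<subseteq> (S \<times> UNIV)" for w
  proof -
    obtain v where v: "v \<in> reduced_words S" "word_val F v = word_val F w"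
      "word_val E (map_word f v) = word_val E (map_word f w)"
      using reduced_word_same_values[OF assms(1,3) S assms(4) w] by blast
    have "word (word_val F w) = v"
      using v bij by (simp add: word_def bij_betw_def the_inv_into_f_f flip: v(2))
    then show ?thesis using v(3) by (simp add: h_def)
  qed
  show thesis
  proof (rule that[of h])
    show "h \<in> hom F E"
    proof (rule homI)
      show "h u \<in> carrier E" if "u \<in> carrier F" for u
        unfolding h_def using set_map_word_subset[OF assms(4) wl[OF that]] by (rule E.word_val_closed)
      fix u v assume u: "u \<in> carrier F" and v: "v \<in> carrier F"
      have "h (u \<otimes>\<^bsub>F\<^esub> v) = h (word_val F (word u @ word v))"
        using F.word_val_append[OF lF[OF wl[OF u]] lF[OF wl[OF v]]] word u v by simp
      also have "\<dots> = word_val E (map_word f (word u) @ map_word f (word v))"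
        using h[of "word u @ word v"] wl[OF u] wl[OF v] by simp
      also have "\<dots> = h u \<otimes>\<^bsub>E\<^esub> h v"
        unfolding h_def using set_map_word_subset[OF assms(4) wl[OF u]] set_map_word_subset[OF assms(4) wl[OF v]]
        by (rule E.word_val_append)
      finally show "h (u \<otimes>\<^bsub>F\<^esub> v) = h u \<otimes>\<^bsub>E\<^esub> h v" .
    qed
    fix s assume s: "s \<in> S"
    then have "h s = h (word_val F [(s, True)])" using S by auto
    also have "\<dots> = f s" using s E.r_one[OF funcset_mem[OF assms(4) s]] by (subst h) auto
    finally show "h s = f s" .
  qed
qed

lemma free_basis_hom_unique:
  assumes "group F" "free_basis F S" "group E" "h \<in> hom F E" "k \<in> hom F E"
    and eq: "\<And>s. s \<in> S \<Longrightarrow> h s = k s" and u: "u \<in> carrier F"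
  shows "h u = k u"
proof -
  obtain w where w: "w \<in> reduced_words S" "word_val F w = u"
    using assms(2) u by (metis bij_betw_def free_basis_def imageE)
  have wS: "set w \<subseteq> (S \<times> UNIV)" using w(1) by (simp add: reduced_words_alt)
  have wF: "set w \<subseteq> (carrier F \<times> UNIV)"
    using wS assms(2) unfolding free_basis_def by blast
  have eqw: "map_word h w = map_word k w" using wS eq by (induction w) auto
  show ?thesis
    using group_hom.hom_word_val[OF _ wF, of E h] group_hom.hom_word_val[OF _ wF, of E k] assms(1,3-5) w eqw
    by (simp add: group_hom_def group_hom_axioms_def del: map_eq_conv)
qed

text \<open>The central extension of \<open>G\<close> by \<open>A\<close> with factor set \<alpha>.
  As \<alpha> need not be normalized, the identity carries the inverse of \<alpha>(1,1) in its first
  component.\<close>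

definition twisted_product ::
    "('g, 'm) monoid_scheme \<Rightarrow> ('b, 'n) monoid_scheme \<Rightarrow> ('g \<times> 'g \<Rightarrow> 'b) \<Rightarrow> ('b \<times> 'g) monoid" where
  "twisted_product G A \<alpha> = \<lparr>carrier = carrier A \<times> carrier G,
     monoid.mult = (\<lambda>(a, x) (b, y). (a \<otimes>\<^bsub>A\<^esub> b \<otimes>\<^bsub>A\<^esub> \<alpha> (x, y), x \<otimes>\<^bsub>G\<^esub> y)),
     one = (inv\<^bsub>A\<^esub> (\<alpha> (\<one>\<^bsub>G\<^esub>, \<one>\<^bsub>G\<^esub>)), \<one>\<^bsub>G\<^esub>)\<rparr>"

lemma Z2_closed: "\<alpha> \<in> Z2 G A \<Longrightarrow> x \<in> carrier G \<Longrightarrow> y \<in> carrier G \<Longrightarrow> \<alpha> (x, y) \<in> carrier A"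
  by (auto simp: Z2_def C2_def)

lemma Z2_cocycle:
  "\<alpha> \<in> Z2 G A \<Longrightarrow> x \<in> carrier G \<Longrightarrow> y \<in> carrier G \<Longrightarrow> z \<in> carrier G \<Longrightarrow>
     \<alpha> (y, z) \<otimes>\<^bsub>A\<^esub> \<alpha> (x, y \<otimes>\<^bsub>G\<^esub> z) = \<alpha> (x \<otimes>\<^bsub>G\<^esub> y, z) \<otimes>\<^bsub>A\<^esub> \<alpha> (x, y)"
  by (simp add: Z2_def)

lemma group_twisted_product:
  assumes "group G" "comm_group A" and \<alpha>: "\<alpha> \<in> Z2 G A"
  shows "group (twisted_product G A \<alpha>)"
proof -
  interpret G: group G by fact
  interpret A: comm_group A by fact
  note [simp] = Z2_closed[OF \<alpha>]
  have ac: "a \<otimes>\<^bsub>A\<^esub> b \<otimes>\<^bsub>A\<^esub> s \<otimes>\<^bsub>A\<^esub> c \<otimes>\<^bsub>A\<^esub> t = a \<otimes>\<^bsub>A\<^esub> b \<otimes>\<^bsub>A\<^esub> c \<otimes>\<^bsub>A\<^esub> (t \<otimes>\<^bsub>A\<^esub> s)"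
      "a \<otimes>\<^bsub>A\<^esub> b \<otimes>\<^bsub>A\<^esub> c \<otimes>\<^bsub>A\<^esub> (s \<otimes>\<^bsub>A\<^esub> t) = a \<otimes>\<^bsub>A\<^esub> (b \<otimes>\<^bsub>A\<^esub> c \<otimes>\<^bsub>A\<^esub> s) \<otimes>\<^bsub>A\<^esub> t"
    if "a \<in> carrier A" "b \<in> carrier A" "c \<in> carrier A" "s \<in> carrier A" "t \<in> carrier A" for a b c s t
    using that by (simp_all add: A.m_ac)
  \<comment> \<open>The cocycle identity at (1, 1, x), after cancelling \<alpha>(1,x).\<close>
  have left1: "\<alpha> (\<one>\<^bsub>G\<^esub>, x) = \<alpha> (\<one>\<^bsub>G\<^esub>, \<one>\<^bsub>G\<^esub>)" if "x \<in> carrier G" for x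
    using Z2_cocycle[OF \<alpha> G.one_closed G.one_closed that] that by simp
  show ?thesis
  proof (rule groupI, goal_cases)
    case (3 p q r)
    then obtain a x b y c z where s: "p = (a, x)" "q = (b, y)" "r = (c, z)"
      and [simp]: "a \<in> carrier A" "b \<in> carrier A" "c \<in> carrier A"
        "x \<in> carrier G" "y \<in> carrier G" "z \<in> carrier G"
      by (auto simp: twisted_product_def)
    have "(a \<otimes>\<^bsub>A\<^esub> b \<otimes>\<^bsub>A\<^esub> \<alpha> (x, y)) \<otimes>\<^bsub>A\<^esub> c \<otimes>\<^bsub>A\<^esub> \<alpha> (x \<otimes>\<^bsub>G\<^esub> y, z) =
        (a \<otimes>\<^bsub>A\<^esub> b \<otimes>\<^bsub>A\<^esub> c) \<otimes>\<^bsub>A\<^esub> (\<alpha> (x \<otimes>\<^bsub>G\<^esub> y, z) \<otimes>\<^bsub>A\<^esub> \<alpha> (x, y))"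
      by (rule ac(1)) auto
    also have "\<dots> = (a \<otimes>\<^bsub>A\<^esub> b \<otimes>\<^bsub>A\<^esub> c) \<otimes>\<^bsub>A\<^esub> (\<alpha> (y, z) \<otimes>\<^bsub>A\<^esub> \<alpha> (x, y \<otimes>\<^bsub>G\<^esub> z))"
      by (simp add: Z2_cocycle[OF \<alpha>])
    also have "\<dots> = a \<otimes>\<^bsub>A\<^esub> (b \<otimes>\<^bsub>A\<^esub> c \<otimes>\<^bsub>A\<^esub> \<alpha> (y, z)) \<otimes>\<^bsub>A\<^esub> \<alpha> (x, y \<otimes>\<^bsub>G\<^esub> z)"
      by (rule ac(2)) auto
    finally show ?case by (simp add: s twisted_product_def G.m_assoc)
  next
    case (4 p)
    then obtain a x where s: "p = (a, x)" and [simp]: "a \<in> carrier A" "x \<in> carrier G"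
      by (auto simp: twisted_product_def)
    have "inv\<^bsub>A\<^esub> \<alpha> (\<one>\<^bsub>G\<^esub>, \<one>\<^bsub>G\<^esub>) \<otimes>\<^bsub>A\<^esub> a \<otimes>\<^bsub>A\<^esub> \<alpha> (\<one>\<^bsub>G\<^esub>, \<one>\<^bsub>G\<^esub>) = a"
      by (metis A.inv_solve_left A.m_closed A.m_comm A.inv_closed G.one_closed Z2_closed[OF \<alpha>] \<open>a \<in> carrier A\<close>)
    then show ?case by (simp add: s twisted_product_def left1[of x])
  next
    case (5 p)
    then obtain a x where s: "p = (a, x)" and [simp]: "a \<in> carrier A" "x \<in> carrier G"
      by (auto simp: twisted_product_def)
    \<comment> \<open>Solved from the requirement that the product of \<open>(b, inv x)\<close> and
      \<open>(a, x)\<close> have the first component of the identity.\<close>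
    define b where "b = inv\<^bsub>A\<^esub> \<alpha> (\<one>\<^bsub>G\<^esub>, \<one>\<^bsub>G\<^esub>) \<otimes>\<^bsub>A\<^esub> inv\<^bsub>A\<^esub> (a \<otimes>\<^bsub>A\<^esub> \<alpha> (inv\<^bsub>G\<^esub> x, x))"
    have b: "b \<in> carrier A" by (simp add: b_def)
    then have "b \<otimes>\<^bsub>A\<^esub> a \<otimes>\<^bsub>A\<^esub> \<alpha> (inv\<^bsub>G\<^esub> x, x) = b \<otimes>\<^bsub>A\<^esub> (a \<otimes>\<^bsub>A\<^esub> \<alpha> (inv\<^bsub>G\<^esub> x, x))"
      by (simp add: A.m_assoc)
    also have "\<dots> = inv\<^bsub>A\<^esub> \<alpha> (\<one>\<^bsub>G\<^esub>, \<one>\<^bsub>G\<^esub>)"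
      unfolding b_def by (subst A.m_assoc) (auto simp: A.l_inv simp del: A.inv_mult)
    finally show ?case using b
      by (intro bexI[of _ "(b, inv\<^bsub>G\<^esub> x)"]) (simp_all add: s twisted_product_def)
  qed (auto simp: twisted_product_def)
qed

text \<open>The pullback of \<alpha> along \<open>p\<close> is the coboundary of the pointwise
  inverse of \<phi>. For a homomorphism \<open>p\<close> and a cocycle \<alpha> this says that
  \<open>u\<close> \<mapsto> (\<phi> u, p u) is a homomorphism into
  \<open>twisted_product G A \<alpha>\<close>.\<close>

definition trivializes ::
    "('f, 'm) monoid_scheme \<Rightarrow> ('f \<Rightarrow> 'g) \<Rightarrow> ('b, 'n) monoid_scheme
      \<Rightarrow> ('f \<Rightarrow> 'b) \<Rightarrow> ('g \<times> 'g \<Rightarrow> 'b) \<Rightarrow> bool" where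
  "trivializes F p A \<phi> \<alpha> \<longleftrightarrow> \<phi> \<in> carrier F \<rightarrow> carrier A \<and>
     (\<forall>u\<in>carrier F. \<forall>v\<in>carrier F.
        \<phi> (u \<otimes>\<^bsub>F\<^esub> v) = \<phi> u \<otimes>\<^bsub>A\<^esub> \<phi> v \<otimes>\<^bsub>A\<^esub> \<alpha> (p u, p v))"

text \<open>A lift of \<open>p\<close> to the extension of \<open>G\<close> by \<open>A\<close> given by \<open>\<alpha>\<close> has the trivialization as its
  \<open>A\<close>-component.\<close>

lemma free_group_trivializes:
  assumes "free_group F" "group G" "comm_group A" "p \<in> hom F G" and \<alpha>: "\<alpha> \<in> Z2 G A"
  obtains \<phi> where "trivializes F p A \<phi> \<alpha>"
proof -
  interpret G: group G by fact
  interpret A: comm_group A by fact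
  let ?E = "twisted_product G A \<alpha>"
  obtain S where F: "group F" and S: "free_basis F S" using assms(1) by (auto simp: free_group_def)
  then have SF: "S \<subseteq> carrier F" by (simp add: free_basis_def)
  have E: "group ?E" by (rule group_twisted_product[OF assms(2,3) \<alpha>])
  \<comment> \<open>On the basis the first component is free to choose; it is set to 1.\<close>
  have "(\<lambda>s. (\<one>\<^bsub>A\<^esub>, p s)) \<in> S \<rightarrow> carrier ?E"
    using SF assms(4) by (auto simp: twisted_product_def hom_def)
  then obtain h where h: "h \<in> hom F ?E" and hS: "\<And>s. s \<in> S \<Longrightarrow> h s = (\<one>\<^bsub>A\<^esub>, p s)"
    using free_basis_hom_exists[OF F S E] by blast
  have hc: "h u \<in> carrier A \<times> carrier G" if "u \<in> carrier F" for u
    using h that by (auto simp: hom_def twisted_product_def)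
  have hm: "h (u \<otimes>\<^bsub>F\<^esub> v) =
      (fst (h u) \<otimes>\<^bsub>A\<^esub> fst (h v) \<otimes>\<^bsub>A\<^esub> \<alpha> (snd (h u), snd (h v)), snd (h u) \<otimes>\<^bsub>G\<^esub> snd (h v))"
    if "u \<in> carrier F" "v \<in> carrier F" for u v
    using hom_mult[OF h that] by (simp add: twisted_product_def split_beta)
  \<comment> \<open>The second component of the lift is a homomorphism that agrees with
    \<open>p\<close> on the basis, hence it is \<open>p\<close>.\<close>
  have "snd \<circ> h \<in> hom F G"
    by (rule homI) (use hc hm in \<open>auto simp: mem_Times_iff\<close>)
  then have p: "snd (h u) = p u" if "u \<in> carrier F" for u
    using free_basis_hom_unique[OF F S assms(2) _ assms(4) _ that, of "snd \<circ> h"] hS by simp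
  have "trivializes F p A (fst \<circ> h) \<alpha>"
    using hc hm p by (auto simp: trivializes_def mem_Times_iff)
  then show thesis by (rule that)
qed

section \<open>Second cohomology and the Bogomolov multiplier\<close>

abbreviation Z2_group ::
    "('g, 'm) monoid_scheme \<Rightarrow> ('b, 'n) monoid_scheme \<Rightarrow> ('g \<times> 'g \<Rightarrow> 'b) monoid" where
  "Z2_group G A \<equiv> (C2 G A)\<lparr>carrier := Z2 G A\<rparr>"

abbreviation coboundary ::
    "('g, 'm) monoid_scheme \<Rightarrow> ('b, 'n) monoid_scheme \<Rightarrow> ('g \<Rightarrow> 'b) \<Rightarrow> 'g \<times> 'g \<Rightarrow> 'b" where
  "coboundary G A c \<equiv>
     (\<lambda>(x, y)\<in>carrier G \<times> carrier G. c x \<otimes>\<^bsub>A\<^esub> c y \<otimes>\<^bsub>A\<^esub> inv\<^bsub>A\<^esub> (c (x \<otimes>\<^bsub>G\<^esub> y)))"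

lemma B2_iff: "\<beta> \<in> B2 G A \<longleftrightarrow> (\<exists>c\<in>carrier G \<rightarrow> carrier A. \<beta> = coboundary G A c)"
  by (auto simp: B2_def)

lemma (in comm_group) comm_group_subgroup:
  assumes "subgroup H G"
  shows "comm_group (G\<lparr>carrier := H\<rparr>)"
  using subgroup.mem_carrier[OF assms]
  by (intro group.group_comm_groupI[OF subgroup_imp_group[OF assms]]) (auto intro: m_comm)

lemma (in comm_group) m_swap4:
  "\<lbrakk>a \<in> carrier G; b \<in> carrier G; c \<in> carrier G; d \<in> carrier G\<rbrakk>
    \<Longrightarrow> a \<otimes> b \<otimes> (c \<otimes> d) = a \<otimes> c \<otimes> (b \<otimes> d)"
  by (simp add: m_ac)

lemma (in comm_group) m_swap6:
  "\<lbrakk>a \<in> carrier G; b \<in> carrier G; c \<in> carrier G; a' \<in> carrier G; b' \<in> carrier G; c' \<in> carrier G\<rbrakk>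
    \<Longrightarrow> a \<otimes> b \<otimes> c \<otimes> (a' \<otimes> b' \<otimes> c') = (a \<otimes> a') \<otimes> (b \<otimes> b') \<otimes> (c \<otimes> c')"
  by (simp add: m_ac)

locale cohomology = G: group G + A: comm_group A
  for G :: "('g, 'm) monoid_scheme" and A :: "('b, 'n) monoid_scheme"
begin

lemma comm_group_C2: "comm_group (C2 G A)"
proof -
  have "group (C2 G A)" unfolding C2_def by (simp add: A.is_group)
  then show ?thesis
    by (rule group.group_comm_groupI) (auto simp: C2_def PiE_iff A.m_comm intro!: restrict_ext)
qed

sublocale C2: comm_group "C2 G A" by (rule comm_group_C2)

lemma C2_mult: "x \<in> carrier G \<Longrightarrow> y \<in> carrier G \<Longrightarrow>
    (\<alpha> \<otimes>\<^bsub>C2 G A\<^esub> \<beta>) (x, y) = \<alpha> (x, y) \<otimes>\<^bsub>A\<^esub> \<beta> (x, y)"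
  by (simp add: C2_def)

lemma C2_inv: "\<alpha> \<in> carrier (C2 G A) \<Longrightarrow> x \<in> carrier G \<Longrightarrow> y \<in> carrier G \<Longrightarrow>
    (inv\<^bsub>C2 G A\<^esub> \<alpha>) (x, y) = inv\<^bsub>A\<^esub> (\<alpha> (x, y))"
  by (simp add: C2_def A.is_group)

lemma C2_eqI:
  assumes "\<alpha> \<in> carrier (C2 G A)" "\<beta> \<in> carrier (C2 G A)"
    "\<And>x y. x \<in> carrier G \<Longrightarrow> y \<in> carrier G \<Longrightarrow> \<alpha> (x, y) = \<beta> (x, y)"
  shows "\<alpha> = \<beta>"
proof (rule PiE_ext)
  show "\<alpha> \<in> (\<Pi>\<^sub>E _\<in>carrier G \<times> carrier G. carrier A)" "\<beta> \<in> (\<Pi>\<^sub>E _\<in>carrier G \<times> carrier G. carrier A)"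
    using assms(1,2) by (simp_all add: C2_def)
qed (use assms(3) in auto)

lemma C2_closed: "\<alpha> \<in> carrier (C2 G A) \<Longrightarrow> x \<in> carrier G \<Longrightarrow> y \<in> carrier G \<Longrightarrow> \<alpha> (x, y) \<in> carrier A"
  by (auto simp: C2_def)

lemma Z2_subset: "Z2 G A \<subseteq> carrier (C2 G A)"
  by (auto simp: Z2_def)

lemma subgroup_Z2: "subgroup (Z2 G A) (C2 G A)"
proof (rule C2.subgroupI)
  show "Z2 G A \<subseteq> carrier (C2 G A)" by (rule Z2_subset)
  have "(\<lambda>p\<in>carrier G \<times> carrier G. \<one>\<^bsub>A\<^esub>) \<in> Z2 G A" by (auto simp: Z2_def C2_def)
  then show "Z2 G A \<noteq> {}" by blast
next
  fix \<alpha> assume \<alpha>: "\<alpha> \<in> Z2 G A"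
  then have c: "\<alpha> \<in> carrier (C2 G A)" using Z2_subset by blast
  have "inv\<^bsub>A\<^esub> \<alpha> (y, z) \<otimes>\<^bsub>A\<^esub> inv\<^bsub>A\<^esub> \<alpha> (x, y \<otimes>\<^bsub>G\<^esub> z) = inv\<^bsub>A\<^esub> \<alpha> (x \<otimes>\<^bsub>G\<^esub> y, z) \<otimes>\<^bsub>A\<^esub> inv\<^bsub>A\<^esub> \<alpha> (x, y)"
    if "x \<in> carrier G" "y \<in> carrier G" "z \<in> carrier G" for x y z
    using Z2_cocycle[OF \<alpha> that] that Z2_closed[OF \<alpha>] by (simp flip: A.inv_mult)
  then show "inv\<^bsub>C2 G A\<^esub> \<alpha> \<in> Z2 G A"
    unfolding Z2_def using C2.inv_closed[OF c] by (simp add: C2_inv[OF c])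
next
  fix \<alpha> \<beta> assume \<alpha>: "\<alpha> \<in> Z2 G A" and \<beta>: "\<beta> \<in> Z2 G A"
  then have c: "\<alpha> \<in> carrier (C2 G A)" "\<beta> \<in> carrier (C2 G A)" using Z2_subset by blast+
  have "\<alpha> (y, z) \<otimes>\<^bsub>A\<^esub> \<beta> (y, z) \<otimes>\<^bsub>A\<^esub> (\<alpha> (x, y \<otimes>\<^bsub>G\<^esub> z) \<otimes>\<^bsub>A\<^esub> \<beta> (x, y \<otimes>\<^bsub>G\<^esub> z)) =
      \<alpha> (x \<otimes>\<^bsub>G\<^esub> y, z) \<otimes>\<^bsub>A\<^esub> \<beta> (x \<otimes>\<^bsub>G\<^esub> y, z) \<otimes>\<^bsub>A\<^esub> (\<alpha> (x, y) \<otimes>\<^bsub>A\<^esub> \<beta> (x, y))" (is "?l = ?r")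
    if "x \<in> carrier G" "y \<in> carrier G" "z \<in> carrier G" for x y z
  proof -
    note closed = Z2_closed[OF \<alpha>] Z2_closed[OF \<beta>]
    have "?l = \<alpha> (y, z) \<otimes>\<^bsub>A\<^esub> \<alpha> (x, y \<otimes>\<^bsub>G\<^esub> z) \<otimes>\<^bsub>A\<^esub> (\<beta> (y, z) \<otimes>\<^bsub>A\<^esub> \<beta> (x, y \<otimes>\<^bsub>G\<^esub> z))"
      using that closed by (intro A.m_swap4) auto
    also have "\<dots> = \<alpha> (x \<otimes>\<^bsub>G\<^esub> y, z) \<otimes>\<^bsub>A\<^esub> \<alpha> (x, y) \<otimes>\<^bsub>A\<^esub> (\<beta> (x \<otimes>\<^bsub>G\<^esub> y, z) \<otimes>\<^bsub>A\<^esub> \<beta> (x, y))"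
      using Z2_cocycle[OF \<alpha> that] Z2_cocycle[OF \<beta> that] by simp
    also have "\<dots> = ?r"
      using that closed by (intro A.m_swap4) auto
    finally show ?thesis .
  qed
  then show "\<alpha> \<otimes>\<^bsub>C2 G A\<^esub> \<beta> \<in> Z2 G A"
    unfolding Z2_def using C2.m_closed[OF c] by (simp add: C2_mult)
qed

lemma comm_group_Z2: "comm_group (Z2_group G A)"
  by (rule C2.comm_group_subgroup[OF subgroup_Z2])

sublocale Z2: comm_group "Z2_group G A" by (rule comm_group_Z2)

lemma coboundary_closed: "c \<in> carrier G \<rightarrow> carrier A \<Longrightarrow> coboundary G A c \<in> carrier (C2 G A)"
  by (auto simp: C2_def)

lemma coboundary_in_Z2:
  assumes c: "c \<in> carrier G \<rightarrow> carrier A"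
  shows "coboundary G A c \<in> Z2 G A"
proof -
  have "c y \<otimes>\<^bsub>A\<^esub> c z \<otimes>\<^bsub>A\<^esub> inv\<^bsub>A\<^esub> c (y \<otimes>\<^bsub>G\<^esub> z) \<otimes>\<^bsub>A\<^esub>
        (c x \<otimes>\<^bsub>A\<^esub> c (y \<otimes>\<^bsub>G\<^esub> z) \<otimes>\<^bsub>A\<^esub> inv\<^bsub>A\<^esub> c (x \<otimes>\<^bsub>G\<^esub> (y \<otimes>\<^bsub>G\<^esub> z))) =
      c (x \<otimes>\<^bsub>G\<^esub> y) \<otimes>\<^bsub>A\<^esub> c z \<otimes>\<^bsub>A\<^esub> inv\<^bsub>A\<^esub> c (x \<otimes>\<^bsub>G\<^esub> y \<otimes>\<^bsub>G\<^esub> z) \<otimes>\<^bsub>A\<^esub>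
        (c x \<otimes>\<^bsub>A\<^esub> c y \<otimes>\<^bsub>A\<^esub> inv\<^bsub>A\<^esub> c (x \<otimes>\<^bsub>G\<^esub> y))" (is "?l = ?r")
    if [simp]: "x \<in> carrier G" "y \<in> carrier G" "z \<in> carrier G" for x y z
  proof -
    have [simp]: "c u \<in> carrier A" if "u \<in> carrier G" for u using c that by blast
    have ac: "b \<otimes>\<^bsub>A\<^esub> d \<otimes>\<^bsub>A\<^esub> s \<otimes>\<^bsub>A\<^esub> (a \<otimes>\<^bsub>A\<^esub> t \<otimes>\<^bsub>A\<^esub> e) = a \<otimes>\<^bsub>A\<^esub> b \<otimes>\<^bsub>A\<^esub> d \<otimes>\<^bsub>A\<^esub> e \<otimes>\<^bsub>A\<^esub> (t \<otimes>\<^bsub>A\<^esub> s)"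
        "a \<otimes>\<^bsub>A\<^esub> b \<otimes>\<^bsub>A\<^esub> d \<otimes>\<^bsub>A\<^esub> e \<otimes>\<^bsub>A\<^esub> (t \<otimes>\<^bsub>A\<^esub> s) = t \<otimes>\<^bsub>A\<^esub> d \<otimes>\<^bsub>A\<^esub> e \<otimes>\<^bsub>A\<^esub> (a \<otimes>\<^bsub>A\<^esub> b \<otimes>\<^bsub>A\<^esub> s)"
      if "a \<in> carrier A" "b \<in> carrier A" "d \<in> carrier A" "e \<in> carrier A" "s \<in> carrier A" "t \<in> carrier A"
      for a b d e s t
      using that by (simp_all add: A.m_ac)
    \<comment> \<open>\<open>?k\<close> collects the factors common to both sides of the cocycle
      identity. What remains on either side is a value of \<open>c\<close> times its
      inverse.\<close>
    let ?k = "c x \<otimes>\<^bsub>A\<^esub> c y \<otimes>\<^bsub>A\<^esub> c z \<otimes>\<^bsub>A\<^esub> inv\<^bsub>A\<^esub> c (x \<otimes>\<^bsub>G\<^esub> (y \<otimes>\<^bsub>G\<^esub> z))"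
    have "?l = ?k \<otimes>\<^bsub>A\<^esub> (c (y \<otimes>\<^bsub>G\<^esub> z) \<otimes>\<^bsub>A\<^esub> inv\<^bsub>A\<^esub> c (y \<otimes>\<^bsub>G\<^esub> z))"
      by (rule ac(1)) auto
    also have "\<dots> = ?k \<otimes>\<^bsub>A\<^esub> (c (x \<otimes>\<^bsub>G\<^esub> y) \<otimes>\<^bsub>A\<^esub> inv\<^bsub>A\<^esub> c (x \<otimes>\<^bsub>G\<^esub> y))" by simp
    also have "\<dots> = ?r" unfolding G.m_assoc[OF that] by (rule ac(2)) auto
    finally show ?thesis .
  qed
  then show ?thesis unfolding Z2_def using coboundary_closed[OF c] by simp
qed

lemma subgroup_B2: "subgroup (B2 G A) (Z2_group G A)"
proof -
  have "subgroup (B2 G A) (C2 G A)"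
  proof (rule C2.subgroupI)
    show "B2 G A \<subseteq> carrier (C2 G A)" using coboundary_closed by (auto simp: B2_iff)
    have "coboundary G A (\<lambda>_. \<one>\<^bsub>A\<^esub>) \<in> B2 G A"
      unfolding B2_iff by (intro bexI[of _ "\<lambda>_. \<one>\<^bsub>A\<^esub>"]) auto
    then show "B2 G A \<noteq> {}" by blast
  next
    fix \<beta> assume "\<beta> \<in> B2 G A"
    then obtain c where c: "c \<in> carrier G \<rightarrow> carrier A" and \<beta>: "\<beta> = coboundary G A c"
      by (auto simp: B2_iff)
    have [simp]: "c u \<in> carrier A" if "u \<in> carrier G" for u using c that by blast
    have "inv\<^bsub>C2 G A\<^esub> \<beta> = coboundary G A (\<lambda>x. inv\<^bsub>A\<^esub> c x)"
      using coboundary_closed[OF c] coboundary_closed[of "\<lambda>x. inv\<^bsub>A\<^esub> c x"] unfolding \<beta>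
      by (intro C2_eqI) (auto simp: C2_inv A.inv_mult)
    then show "inv\<^bsub>C2 G A\<^esub> \<beta> \<in> B2 G A" unfolding B2_iff by (intro bexI) auto
  next
    fix \<beta> \<gamma> assume "\<beta> \<in> B2 G A" "\<gamma> \<in> B2 G A"
    then obtain c d where c: "c \<in> carrier G \<rightarrow> carrier A" and \<beta>: "\<beta> = coboundary G A c"
      and d: "d \<in> carrier G \<rightarrow> carrier A" and \<gamma>: "\<gamma> = coboundary G A d"
      by (auto simp: B2_iff)
    have [simp]: "c u \<in> carrier A" "d u \<in> carrier A" if "u \<in> carrier G" for u
      using c d that by blast+
    have "\<beta> \<otimes>\<^bsub>C2 G A\<^esub> \<gamma> = coboundary G A (\<lambda>x. c x \<otimes>\<^bsub>A\<^esub> d x)"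
    proof (rule C2_eqI)
      show "\<beta> \<otimes>\<^bsub>C2 G A\<^esub> \<gamma> \<in> carrier (C2 G A)"
        using coboundary_closed[OF c] coboundary_closed[OF d] by (simp add: \<beta> \<gamma>)
      show "coboundary G A (\<lambda>x. c x \<otimes>\<^bsub>A\<^esub> d x) \<in> carrier (C2 G A)"
        by (rule coboundary_closed) auto
      show "(\<beta> \<otimes>\<^bsub>C2 G A\<^esub> \<gamma>) (x, y) = coboundary G A (\<lambda>x. c x \<otimes>\<^bsub>A\<^esub> d x) (x, y)"
        if "x \<in> carrier G" "y \<in> carrier G" for x y
        using that by (simp add: \<beta> \<gamma> C2_mult A.m_swap6 A.inv_mult)
    qed
    then show "\<beta> \<otimes>\<^bsub>C2 G A\<^esub> \<gamma> \<in> B2 G A" unfolding B2_iff by (intro bexI) auto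
  qed
  then show ?thesis
    using subgroup_Z2 coboundary_in_Z2 by (intro C2.subgroup_incl) (auto simp: B2_iff)
qed

sublocale B2: normal "B2 G A" "Z2_group G A"
  by (rule Z2.subgroup_imp_normal[OF subgroup_B2])

lemma comm_group_H2: "comm_group (H2 G A)"
  unfolding H2_def by (rule Z2.abelian_FactGroup[OF subgroup_B2])

text \<open>\<open>H2_class\<close> is a coset in the cochain group while \<open>H2\<close> is a
  quotient of the cocycle group. The two share their multiplication, so facts on quotient groups
  apply to classes.\<close>

lemma H2_class_eq: "H2_class G A \<alpha> = B2 G A #>\<^bsub>Z2_group G A\<^esub> \<alpha>"
  by (simp add: H2_class_def r_coset_def)

lemma H2_class_hom: "H2_class G A \<in> hom (Z2_group G A) (H2 G A)"
  using B2.r_coset_hom_Mod by (simp add: H2_def H2_class_eq[abs_def])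

lemma carrier_H2: "carrier (H2 G A) = H2_class G A ` Z2 G A"
  by (simp add: H2_def carrier_FactGroup H2_class_eq)

lemma one_H2: "\<one>\<^bsub>H2 G A\<^esub> = B2 G A"
  by (simp add: H2_def)

lemma H2_class_eq_one_iff:
  assumes "\<alpha> \<in> Z2 G A"
  shows "H2_class G A \<alpha> = \<one>\<^bsub>H2 G A\<^esub> \<longleftrightarrow> \<alpha> \<in> B2 G A"
proof
  assume "H2_class G A \<alpha> = \<one>\<^bsub>H2 G A\<^esub>"
  then show "\<alpha> \<in> B2 G A"
    using Z2.rcos_self[OF _ subgroup_B2, of \<alpha>] assms by (simp add: one_H2 H2_class_eq)
next
  assume "\<alpha> \<in> B2 G A"
  then show "H2_class G A \<alpha> = \<one>\<^bsub>H2 G A\<^esub>"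
    using B2.rcos_const[OF Z2.is_group] by (simp add: one_H2 H2_class_eq)
qed

lemma mem_H2_class: "\<gamma> \<in> H2_class G A \<alpha> \<longleftrightarrow> (\<exists>\<beta>\<in>B2 G A. \<gamma> = \<beta> \<otimes>\<^bsub>C2 G A\<^esub> \<alpha>)"
  by (auto simp: H2_class_def r_coset_def)

end

section \<open>Restriction to subgroups\<close>

lemma cohomology_subgroup:
  assumes "cohomology G A" "subgroup S G"
  shows "cohomology (G\<lparr>carrier := S\<rparr>) A"
  using assms by (simp add: cohomology_def group.subgroup_imp_group)

lemma (in cohomology) restrict_Z2:
  assumes S: "subgroup S G" and \<alpha>: "\<alpha> \<in> Z2 G A"
  shows "restrict \<alpha> (S \<times> S) \<in> Z2 (G\<lparr>carrier := S\<rparr>) A"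
proof -
  interpret S: subgroup S G by fact
  show ?thesis
    unfolding Z2_def using \<alpha> by (auto simp: C2_def Z2_closed Z2_cocycle)
qed

lemma (in cohomology) res2_H2_class:
  assumes S: "subgroup S G" and \<alpha>: "\<alpha> \<in> Z2 G A"
  shows "res2 G A S (H2_class G A \<alpha>) = H2_class (G\<lparr>carrier := S\<rparr>) A (restrict \<alpha> (S \<times> S))"
proof -
  interpret S: subgroup S G by fact
  interpret S: cohomology "G\<lparr>carrier := S\<rparr>" A
    by (rule cohomology_subgroup[OF cohomology_axioms S])
  let ?c = "\<lambda>\<gamma>. H2_class (G\<lparr>carrier := S\<rparr>) A (restrict \<gamma> (S \<times> S))"
  have "?c \<gamma> = ?c \<alpha>" if "\<gamma> \<in> H2_class G A \<alpha>" for \<gamma>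
  proof -
    obtain c where c: "c \<in> carrier G \<rightarrow> carrier A"
      and \<gamma>: "\<gamma> = coboundary G A c \<otimes>\<^bsub>C2 G A\<^esub> \<alpha>"
      using \<open>\<gamma> \<in> H2_class G A \<alpha>\<close> by (auto simp: mem_H2_class B2_iff)
    have cS: "c \<in> S \<rightarrow> carrier A" using c by auto
    have "restrict \<gamma> (S \<times> S) = coboundary (G\<lparr>carrier := S\<rparr>) A c \<otimes>\<^bsub>C2 (G\<lparr>carrier := S\<rparr>) A\<^esub> restrict \<alpha> (S \<times> S)"
      by (auto simp: \<gamma> C2_def fun_eq_iff)
    moreover have b: "coboundary (G\<lparr>carrier := S\<rparr>) A c \<in> B2 (G\<lparr>carrier := S\<rparr>) A"
      using cS by (auto simp: B2_iff)
    moreover have "restrict \<gamma> (S \<times> S) \<in> H2_class (G\<lparr>carrier := S\<rparr>) A (restrict \<alpha> (S \<times> S))"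
      unfolding S.mem_H2_class using calculation by blast
    ultimately show ?thesis
      using S.Z2.repr_independence[OF _ _ S.subgroup_B2, of "restrict \<gamma> (S \<times> S)" "restrict \<alpha> (S \<times> S)"]
        restrict_Z2[OF S \<alpha>] by (simp add: S.H2_class_eq)
  qed
  moreover have "\<alpha> \<in> H2_class G A \<alpha>"
    using Z2.rcos_self[OF _ subgroup_B2, of \<alpha>] \<alpha> by (simp add: H2_class_eq)
  ultimately have "?c ` H2_class G A \<alpha> = {?c \<alpha>}" by blast
  then show ?thesis by (simp add: res2_def)
qed

text \<open>Translates the kernels of restriction into a condition on a representing cocycle, the
  form in which trivializations can be applied.\<close>

lemma Bogomolov_multiplier_class_iff:
  assumes "group G" and \<alpha>: "\<alpha> \<in> Z2 G QZ"
  shows "H2_class G QZ \<alpha> \<in> carrier (Bogomolov_multiplier G) \<longleftrightarrow>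
    (\<forall>S. subgroup S G \<longrightarrow> comm_group (G\<lparr>carrier := S\<rparr>) \<longrightarrow>
       restrict \<alpha> (S \<times> S) \<in> B2 (G\<lparr>carrier := S\<rparr>) QZ)"
proof -
  interpret cohomology G QZ
    using assms(1) divisible_QZ by (simp add: cohomology_def divisible_group_def)
  have "H2_class G QZ \<alpha> \<in> kernel (H2 G QZ) (H2 (G\<lparr>carrier := S\<rparr>) QZ) (res2 G QZ S) \<longleftrightarrow>
      restrict \<alpha> (S \<times> S) \<in> B2 (G\<lparr>carrier := S\<rparr>) QZ" if S: "subgroup S G" for S
    using cohomology.H2_class_eq_one_iff[OF cohomology_subgroup[OF cohomology_axioms S] restrict_Z2[OF S \<alpha>]]
      \<alpha> by (auto simp: kernel_def res2_H2_class[OF S \<alpha>] carrier_H2)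
  then show ?thesis by (auto simp: Bogomolov_multiplier_def)
qed

lemma Bogomolov_multiplier_subset:
  assumes "group G"
  shows "carrier (Bogomolov_multiplier G) \<subseteq> H2_class G QZ ` Z2 G QZ"
proof -
  interpret cohomology G QZ
    using assms(1) divisible_QZ by (simp add: cohomology_def divisible_group_def)
  \<comment> \<open>The trivial subgroup shows that the family of abelian subgroups is nonempty.
    Over an empty family the intersection would be \<open>UNIV\<close>.\<close>
  have "subgroup {\<one>\<^bsub>G\<^esub>} G" by (rule G.triv_subgroup)
  moreover have "comm_group (G\<lparr>carrier := {\<one>\<^bsub>G\<^esub>}\<rparr>)"
    by (rule comm_groupI) auto
  ultimately show ?thesis
    by (auto simp: Bogomolov_multiplier_def kernel_def simp flip: carrier_H2)
qed

section \<open>Cochains trivialized on a cover\<close>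

lemma (in group) hom_trivial_on_generate:
  assumes H: "subgroup H G" and "group A" and \<chi>: "\<chi> \<in> hom (G\<lparr>carrier := H\<rparr>) A"
    and T: "T \<subseteq> H" "\<And>t. t \<in> T \<Longrightarrow> \<chi> t = \<one>\<^bsub>A\<^esub>" and g: "g \<in> generate G T"
  shows "\<chi> g = \<one>\<^bsub>A\<^esub>"
proof -
  interpret \<chi>: group_hom "G\<lparr>carrier := H\<rparr>" A \<chi>
    using assms by (simp add: group_hom_def group_hom_axioms_def subgroup_imp_group)
  have "subgroup (kernel (G\<lparr>carrier := H\<rparr>) A \<chi>) G"
    by (rule incl_subgroup[OF H \<chi>.subgroup_kernel])
  moreover have "T \<subseteq> kernel (G\<lparr>carrier := H\<rparr>) A \<chi>" using T by (auto simp: kernel_def)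
  ultimately have "generate G T \<subseteq> kernel (G\<lparr>carrier := H\<rparr>) A \<chi>"
    by (intro generate_subgroup_incl)
  then show ?thesis using g by (auto simp: kernel_def)
qed

text \<open>\<open>derived_set\<close> uses the convention h k h^-1 k^-1, \<open>commutators\<close>
  the convention x^-1 y^-1 x y; passing to inverses of the arguments converts one into the
  other.\<close>

lemma (in group) derived_set_subset_commutators:
  assumes "S \<subseteq> carrier G"
  shows "derived_set G S \<subseteq> commutators G"
proof
  fix g assume "g \<in> derived_set G S"
  then obtain h k where hk: "h \<in> S" "k \<in> S" "g = h \<otimes> k \<otimes> inv h \<otimes> inv k" by blast
  then have "h \<in> carrier G" "k \<in> carrier G" using assms by auto
  then show "g \<in> commutators G"
    unfolding commutators_def using hk(3)
    by (intro CollectI exI[of _ "inv h"] exI[of _ "inv k"]) simp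
qed

text \<open>The double centralizer of commuting elements is abelian.\<close>

lemma (in group) commuting_in_abelian_subgroup:
  assumes a: "a \<in> carrier G" and b: "b \<in> carrier G" and ab: "a \<otimes> b = b \<otimes> a"
  obtains S where "subgroup S G" "comm_group (G\<lparr>carrier := S\<rparr>)" "a \<in> S" "b \<in> S"
proof -
  define C where "C T = {z \<in> carrier G. \<forall>t\<in>T. z \<otimes> t = t \<otimes> z}" for T
  have C: "subgroup (C T) G" if T: "T \<subseteq> carrier G" for T
  proof (rule subgroupI)
    have "\<one> \<in> C T" using T by (auto simp: C_def)
    then show "C T \<noteq> {}" by blast
    show "inv z \<in> C T" if "z \<in> C T" for z
    proof -
      have "inv z \<otimes> t = t \<otimes> inv z" if t: "t \<in> T" for t
      proof -
        have [simp]: "z \<in> carrier G" "t \<in> carrier G" and zt: "z \<otimes> t = t \<otimes> z"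
          using \<open>z \<in> C T\<close> t T by (auto simp: C_def)
        have "t \<otimes> inv z = inv z \<otimes> (z \<otimes> t) \<otimes> inv z" by (simp flip: m_assoc)
        also have "\<dots> = inv z \<otimes> t" unfolding zt by (simp add: m_assoc)
        finally show ?thesis by simp
      qed
      then show ?thesis using that by (simp add: C_def)
    qed
    show "y \<otimes> z \<in> C T" if "y \<in> C T" "z \<in> C T" for y z
      using that T unfolding C_def by (auto simp: subset_iff) (metis m_assoc)
  qed (auto simp: C_def)
  let ?S = "C (C {a, b})"
  have Ca: "C {a, b} \<subseteq> carrier G" by (auto simp: C_def)
  have in_C: "a \<in> C {a, b}" "b \<in> C {a, b}" using a b ab by (auto simp: C_def)
  \<comment> \<open>As \<open>a\<close> and \<open>b\<close> commute, they lie in their own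
    centralizer, so the double centralizer is contained in the centralizer. Any two of its elements
    thus commute.\<close>
  have "?S \<subseteq> C {a, b}" using in_C by (auto simp: C_def)
  then have comm: "x \<otimes> y = y \<otimes> x" if "x \<in> ?S" "y \<in> ?S" for x y
    using that by (auto simp: C_def)
  have "comm_group (G\<lparr>carrier := ?S\<rparr>)"
    using comm by (intro group.group_comm_groupI[OF subgroup_imp_group[OF C[OF Ca]]]) auto
  moreover have "a \<in> ?S" "b \<in> ?S" using a b by (auto simp: C_def)
  ultimately show thesis using that C[OF Ca] by blast
qed

section \<open>Trivialized cochains over a surjection onto \<open>G\<close>\<close>

locale cover = cohomology G A + p: group_hom F G p
  for F :: "('f, 'l) monoid_scheme" and G :: "('g, 'm) monoid_scheme"
    and A :: "('b, 'n) monoid_scheme" and p +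
  assumes surj: "p ` carrier F = carrier G"
begin

lemma lift_exists:
  assumes "x \<in> carrier G"
  obtains u where "u \<in> carrier F" "x = p u"
  using assms surj by blast

abbreviation "R \<equiv> kernel F G p"

text \<open>The map \<theta> of the overview; the division by \<phi>(1) compensates for cochains
  that are not normalized.\<close>

abbreviation kernel_char :: "('f \<Rightarrow> 'b) \<Rightarrow> 'f \<Rightarrow> 'b" where
  "kernel_char \<phi> r \<equiv> \<phi> r \<otimes>\<^bsub>A\<^esub> inv\<^bsub>A\<^esub> \<phi> \<one>\<^bsub>F\<^esub>"

lemma R_iff: "r \<in> R \<longleftrightarrow> r \<in> carrier F \<and> p r = \<one>\<^bsub>G\<^esub>"
  by (auto simp: kernel_def)

context
  fixes \<phi> \<alpha>
  assumes triv: "trivializes F p A \<phi> \<alpha>" and \<alpha>: "\<alpha> \<in> carrier (C2 G A)"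
begin

lemma triv_closed [simp]: "u \<in> carrier F \<Longrightarrow> \<phi> u \<in> carrier A"
  using triv by (auto simp: trivializes_def)

lemma triv_mult:
  "u \<in> carrier F \<Longrightarrow> v \<in> carrier F \<Longrightarrow> \<phi> (u \<otimes>\<^bsub>F\<^esub> v) = \<phi> u \<otimes>\<^bsub>A\<^esub> \<phi> v \<otimes>\<^bsub>A\<^esub> \<alpha> (p u, p v)"
  using triv by (simp add: trivializes_def)

text \<open>Expand \<phi>(1 u) and cancel \<phi>(u). So \<alpha>(1, -) is constant, and this
  constant is the factor built into \<open>kernel_char\<close>.\<close>

lemma triv_cochain_one:
  assumes u: "u \<in> carrier F"
  shows "\<alpha> (\<one>\<^bsub>G\<^esub>, p u) = inv\<^bsub>A\<^esub> \<phi> \<one>\<^bsub>F\<^esub>"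
proof -
  have c: "\<alpha> (\<one>\<^bsub>G\<^esub>, p u) \<in> carrier A" using u by (intro C2_closed[OF \<alpha>]) auto
  have "\<phi> u = \<phi> \<one>\<^bsub>F\<^esub> \<otimes>\<^bsub>A\<^esub> \<phi> u \<otimes>\<^bsub>A\<^esub> \<alpha> (\<one>\<^bsub>G\<^esub>, p u)"
    using triv_mult[of "\<one>\<^bsub>F\<^esub>" u] u by simp
  also have "\<dots> = \<phi> u \<otimes>\<^bsub>A\<^esub> (\<alpha> (\<one>\<^bsub>G\<^esub>, p u) \<otimes>\<^bsub>A\<^esub> \<phi> \<one>\<^bsub>F\<^esub>)"
    using u c by (simp add: A.m_ac)
  finally have "\<alpha> (\<one>\<^bsub>G\<^esub>, p u) \<otimes>\<^bsub>A\<^esub> \<phi> \<one>\<^bsub>F\<^esub> = \<one>\<^bsub>A\<^esub>"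
    using u c by (metis A.l_cancel_one' A.m_closed p.G.one_closed triv_closed)
  then show ?thesis using c by (metis A.inv_equality p.G.one_closed triv_closed A.inv_inv)
qed

text \<open>On a coset of \<open>R\<close>, \<phi> is determined by one value and the character.
  Taking \<open>u\<close> in \<open>R\<close> shows that the character is multiplicative.\<close>

lemma triv_mult_kernel:
  assumes "r \<in> R" "u \<in> carrier F"
  shows "\<phi> (r \<otimes>\<^bsub>F\<^esub> u) = kernel_char \<phi> r \<otimes>\<^bsub>A\<^esub> \<phi> u"
  using assms triv_cochain_one[OF assms(2)] by (simp add: triv_mult R_iff A.m_ac)

lemma subgroup_R: "subgroup R F"
  by (rule p.subgroup_kernel)

lemma kernel_char_hom: "kernel_char \<phi> \<in> hom (F\<lparr>carrier := R\<rparr>) A"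
proof (rule homI)
  fix r s assume "r \<in> carrier (F\<lparr>carrier := R\<rparr>)" "s \<in> carrier (F\<lparr>carrier := R\<rparr>)"
  then show "kernel_char \<phi> (r \<otimes>\<^bsub>F\<lparr>carrier := R\<rparr>\<^esub> s) = kernel_char \<phi> r \<otimes>\<^bsub>A\<^esub> kernel_char \<phi> s"
    by (simp add: triv_mult_kernel R_iff A.m_assoc)
qed (auto simp: R_iff)

text \<open>The cocycle identity is associativity in \<open>F\<close>: lift the three arguments,
  expand \<phi> of both bracketings, and cancel the common factor.\<close>

lemma triv_Z2: "\<alpha> \<in> Z2 G A"
proof -
  have "\<alpha> (y, z) \<otimes>\<^bsub>A\<^esub> \<alpha> (x, y \<otimes>\<^bsub>G\<^esub> z) = \<alpha> (x \<otimes>\<^bsub>G\<^esub> y, z) \<otimes>\<^bsub>A\<^esub> \<alpha> (x, y)"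
    if xyz: "x \<in> carrier G" "y \<in> carrier G" "z \<in> carrier G" for x y z
  proof -
    obtain u where [simp]: "u \<in> carrier F" and x: "x = p u" using xyz(1) by (rule lift_exists)
    obtain v where [simp]: "v \<in> carrier F" and y: "y = p v" using xyz(2) by (rule lift_exists)
    obtain w where [simp]: "w \<in> carrier F" and z: "z = p w" using xyz(3) by (rule lift_exists)
    note s = x y z
    have ac: "a \<otimes>\<^bsub>A\<^esub> (b \<otimes>\<^bsub>A\<^esub> c \<otimes>\<^bsub>A\<^esub> d) \<otimes>\<^bsub>A\<^esub> e = a \<otimes>\<^bsub>A\<^esub> b \<otimes>\<^bsub>A\<^esub> c \<otimes>\<^bsub>A\<^esub> (d \<otimes>\<^bsub>A\<^esub> e)"
      "a \<otimes>\<^bsub>A\<^esub> b \<otimes>\<^bsub>A\<^esub> d \<otimes>\<^bsub>A\<^esub> c \<otimes>\<^bsub>A\<^esub> e = a \<otimes>\<^bsub>A\<^esub> b \<otimes>\<^bsub>A\<^esub> c \<otimes>\<^bsub>A\<^esub> (e \<otimes>\<^bsub>A\<^esub> d)"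
      if "a \<in> carrier A" "b \<in> carrier A" "c \<in> carrier A" "d \<in> carrier A" "e \<in> carrier A" for a b c d e
      using that by (simp_all add: A.m_ac)
    let ?k = "\<phi> u \<otimes>\<^bsub>A\<^esub> \<phi> v \<otimes>\<^bsub>A\<^esub> \<phi> w"
    note c = C2_closed[OF \<alpha>]
    have "\<phi> (u \<otimes>\<^bsub>F\<^esub> (v \<otimes>\<^bsub>F\<^esub> w)) = \<phi> u \<otimes>\<^bsub>A\<^esub> (\<phi> v \<otimes>\<^bsub>A\<^esub> \<phi> w \<otimes>\<^bsub>A\<^esub> \<alpha> (y, z)) \<otimes>\<^bsub>A\<^esub> \<alpha> (x, y \<otimes>\<^bsub>G\<^esub> z)"
      by (simp add: triv_mult s)
    also have "\<dots> = ?k \<otimes>\<^bsub>A\<^esub> (\<alpha> (y, z) \<otimes>\<^bsub>A\<^esub> \<alpha> (x, y \<otimes>\<^bsub>G\<^esub> z))"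
      using c xyz by (intro ac(1)) auto
    finally have 1: "\<phi> (u \<otimes>\<^bsub>F\<^esub> v \<otimes>\<^bsub>F\<^esub> w) = ?k \<otimes>\<^bsub>A\<^esub> (\<alpha> (y, z) \<otimes>\<^bsub>A\<^esub> \<alpha> (x, y \<otimes>\<^bsub>G\<^esub> z))"
      by (simp add: p.G.m_assoc)
    have "\<phi> (u \<otimes>\<^bsub>F\<^esub> v \<otimes>\<^bsub>F\<^esub> w) = \<phi> u \<otimes>\<^bsub>A\<^esub> \<phi> v \<otimes>\<^bsub>A\<^esub> \<alpha> (x, y) \<otimes>\<^bsub>A\<^esub> \<phi> w \<otimes>\<^bsub>A\<^esub> \<alpha> (x \<otimes>\<^bsub>G\<^esub> y, z)"
      by (simp add: triv_mult s)
    also have "\<dots> = ?k \<otimes>\<^bsub>A\<^esub> (\<alpha> (x \<otimes>\<^bsub>G\<^esub> y, z) \<otimes>\<^bsub>A\<^esub> \<alpha> (x, y))"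
      using c xyz by (intro ac(2)) auto
    finally show ?thesis using 1 c xyz by simp
  qed
  then show ?thesis using \<alpha> by (simp add: Z2_def)
qed

text \<open>If \<alpha> is the coboundary of \<open>c\<close> on \<open>S\<close>, then \<phi>(u)
  c(p u) is multiplicative on the preimage of \<open>S\<close> and extends the character.
  Conversely, for an extension \<psi> the quotient \<psi>/\<phi> is constant on cosets of
  \<open>R\<close>, so it descends to a function on \<open>S\<close> with coboundary
  \<alpha>.\<close>

lemma restrict_in_B2_iff_extends:
  assumes S: "subgroup S G"
  shows "restrict \<alpha> (S \<times> S) \<in> B2 (G\<lparr>carrier := S\<rparr>) A \<longleftrightarrow>
    (\<exists>\<psi>\<in>hom (F\<lparr>carrier := {u \<in> carrier F. p u \<in> S}\<rparr>) A. \<forall>r\<in>R. \<psi> r = kernel_char \<phi> r)"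
    (is "?lhs \<longleftrightarrow> ?rhs")
proof
  interpret S: subgroup S G by fact
  note c\<alpha> = C2_closed[OF \<alpha>]
  {
    assume ?lhs
    then obtain c where c: "c \<in> S \<rightarrow> carrier A"
      and eq: "restrict \<alpha> (S \<times> S) = coboundary (G\<lparr>carrier := S\<rparr>) A c"
      by (auto simp: B2_iff)
    have cc [simp]: "c x \<in> carrier A" if "x \<in> S" for x using c that by blast
    have \<alpha>c: "\<alpha> (x, y) = c x \<otimes>\<^bsub>A\<^esub> c y \<otimes>\<^bsub>A\<^esub> inv\<^bsub>A\<^esub> c (x \<otimes>\<^bsub>G\<^esub> y)" if "x \<in> S" "y \<in> S" for x y
      using fun_cong[OF eq, of "(x, y)"] that by simp
    \<comment> \<open>Evaluating at (1,1) gives c(1), so multiplication by c(p r) on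
      \<open>R\<close> is exactly the normalization in \<open>kernel_char\<close>.\<close>
    have "\<alpha> (\<one>\<^bsub>G\<^esub>, \<one>\<^bsub>G\<^esub>) = c \<one>\<^bsub>G\<^esub>" by (simp add: \<alpha>c A.m_assoc)
    then have c1: "c \<one>\<^bsub>G\<^esub> = inv\<^bsub>A\<^esub> \<phi> \<one>\<^bsub>F\<^esub>" using triv_cochain_one[of "\<one>\<^bsub>F\<^esub>"] by simp
    have ac: "a \<otimes>\<^bsub>A\<^esub> b \<otimes>\<^bsub>A\<^esub> (s \<otimes>\<^bsub>A\<^esub> t \<otimes>\<^bsub>A\<^esub> inv\<^bsub>A\<^esub> w) \<otimes>\<^bsub>A\<^esub> w = a \<otimes>\<^bsub>A\<^esub> s \<otimes>\<^bsub>A\<^esub> (b \<otimes>\<^bsub>A\<^esub> t)"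
      if "a \<in> carrier A" "b \<in> carrier A" "s \<in> carrier A" "t \<in> carrier A" "w \<in> carrier A" for a b s t w
      using that by (simp add: A.m_assoc) (simp add: A.m_ac)
    have "(\<lambda>u. \<phi> u \<otimes>\<^bsub>A\<^esub> c (p u)) \<in> hom (F\<lparr>carrier := {u \<in> carrier F. p u \<in> S}\<rparr>) A"
    proof (rule homI)
      fix u v assume "u \<in> carrier (F\<lparr>carrier := {u \<in> carrier F. p u \<in> S}\<rparr>)"
        "v \<in> carrier (F\<lparr>carrier := {u \<in> carrier F. p u \<in> S}\<rparr>)"
      then have [simp]: "u \<in> carrier F" "p u \<in> S" "v \<in> carrier F" "p v \<in> S" by auto
      show "\<phi> (u \<otimes>\<^bsub>F\<lparr>carrier := {u \<in> carrier F. p u \<in> S}\<rparr>\<^esub> v) \<otimes>\<^bsub>A\<^esub> c (p (u \<otimes>\<^bsub>F\<lparr>carrier := {u \<in> carrier F. p u \<in> S}\<rparr>\<^esub> v)) =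
          \<phi> u \<otimes>\<^bsub>A\<^esub> c (p u) \<otimes>\<^bsub>A\<^esub> (\<phi> v \<otimes>\<^bsub>A\<^esub> c (p v))"
        by (simp add: triv_mult \<alpha>c ac)
    qed auto
    then show ?rhs
      by (rule bexI[rotated]) (simp add: R_iff c1)
  next
    assume ?rhs
    then obtain \<psi> where \<psi>: "\<psi> \<in> hom (F\<lparr>carrier := {u \<in> carrier F. p u \<in> S}\<rparr>) A"
      and \<psi>R: "\<And>r. r \<in> R \<Longrightarrow> \<psi> r = kernel_char \<phi> r" by blast
    have \<psi>c [simp]: "\<psi> u \<in> carrier A" if "u \<in> carrier F" "p u \<in> S" for u
      using hom_in_carrier[OF \<psi>] that by simp
    have \<psi>m: "\<psi> (u \<otimes>\<^bsub>F\<^esub> v) = \<psi> u \<otimes>\<^bsub>A\<^esub> \<psi> v"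
      if "u \<in> carrier F" "p u \<in> S" "v \<in> carrier F" "p v \<in> S" for u v
      using hom_mult[OF \<psi>] that by simp
    \<comment> \<open>An arbitrary choice of lifts; the fact \<open>c\<close> below shows that the
      value of \<open>c\<close> does not depend on it.\<close>
    define m where "m = inv_into (carrier F) p"
    have m: "m x \<in> carrier F" "p (m x) = x" if "x \<in> S" for x
      using that surj S.subset unfolding m_def by (auto intro: inv_into_into f_inv_into_f)
    define c where "c x = \<psi> (m x) \<otimes>\<^bsub>A\<^esub> inv\<^bsub>A\<^esub> \<phi> (m x)" for x
    have c: "c (p u) = \<psi> u \<otimes>\<^bsub>A\<^esub> inv\<^bsub>A\<^esub> \<phi> u" if u [simp]: "u \<in> carrier F" and S' [simp]: "p u \<in> S" for u
    proof -
      note m' [simp] = m[OF S']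
      define r where "r = u \<otimes>\<^bsub>F\<^esub> inv\<^bsub>F\<^esub> m (p u)"
      have r: "r \<in> R" by (simp add: r_def R_iff)
      then have rF [simp]: "r \<in> carrier F" "p r = \<one>\<^bsub>G\<^esub>" by (auto simp: R_iff)
      have ru: "u = r \<otimes>\<^bsub>F\<^esub> m (p u)" by (simp add: r_def p.G.m_assoc)
      \<comment> \<open>Moving along the coset by \<open>r\<close> multiplies \<phi> and \<psi> by
        the same factor, which cancels in the quotient.\<close>
      have "\<phi> u = kernel_char \<phi> r \<otimes>\<^bsub>A\<^esub> \<phi> (m (p u))"
        using triv_mult_kernel[OF r m'(1)] ru by simp
      moreover have "\<psi> u = kernel_char \<phi> r \<otimes>\<^bsub>A\<^esub> \<psi> (m (p u))"
        using \<psi>m[of r "m (p u)"] \<psi>R[OF r] ru by simp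
      moreover have "k \<otimes>\<^bsub>A\<^esub> a \<otimes>\<^bsub>A\<^esub> inv\<^bsub>A\<^esub> (k \<otimes>\<^bsub>A\<^esub> b) = a \<otimes>\<^bsub>A\<^esub> inv\<^bsub>A\<^esub> b"
        if [simp]: "k \<in> carrier A" "a \<in> carrier A" "b \<in> carrier A" for k a b
      proof -
        have "k \<otimes>\<^bsub>A\<^esub> a \<otimes>\<^bsub>A\<^esub> inv\<^bsub>A\<^esub> (k \<otimes>\<^bsub>A\<^esub> b) = a \<otimes>\<^bsub>A\<^esub> k \<otimes>\<^bsub>A\<^esub> (inv\<^bsub>A\<^esub> k \<otimes>\<^bsub>A\<^esub> inv\<^bsub>A\<^esub> b)"
          by (simp add: A.inv_mult A.m_comm[of k a])
        also have "\<dots> = a \<otimes>\<^bsub>A\<^esub> (k \<otimes>\<^bsub>A\<^esub> inv\<^bsub>A\<^esub> k) \<otimes>\<^bsub>A\<^esub> inv\<^bsub>A\<^esub> b"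
          by (simp only: A.m_assoc A.m_closed A.inv_closed that)
        finally show ?thesis by simp
      qed
      ultimately show ?thesis by (simp add: c_def)
    qed
    have ac0: "(a \<otimes>\<^bsub>A\<^esub> s') \<otimes>\<^bsub>A\<^esub> (b \<otimes>\<^bsub>A\<^esub> t') \<otimes>\<^bsub>A\<^esub> (a' \<otimes>\<^bsub>A\<^esub> b' \<otimes>\<^bsub>A\<^esub> (s \<otimes>\<^bsub>A\<^esub> t \<otimes>\<^bsub>A\<^esub> w)) =
        (a \<otimes>\<^bsub>A\<^esub> a') \<otimes>\<^bsub>A\<^esub> (b \<otimes>\<^bsub>A\<^esub> b') \<otimes>\<^bsub>A\<^esub> (s \<otimes>\<^bsub>A\<^esub> s') \<otimes>\<^bsub>A\<^esub> (t \<otimes>\<^bsub>A\<^esub> t') \<otimes>\<^bsub>A\<^esub> w"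
      if "a \<in> carrier A" "b \<in> carrier A" "s \<in> carrier A" "t \<in> carrier A" "w \<in> carrier A"
        "a' \<in> carrier A" "b' \<in> carrier A" "s' \<in> carrier A" "t' \<in> carrier A" for a b s t w a' b' s' t'
      using that by (simp add: A.m_ac)
    have ac: "(a \<otimes>\<^bsub>A\<^esub> inv\<^bsub>A\<^esub> s) \<otimes>\<^bsub>A\<^esub> (b \<otimes>\<^bsub>A\<^esub> inv\<^bsub>A\<^esub> t) \<otimes>\<^bsub>A\<^esub> inv\<^bsub>A\<^esub> (a \<otimes>\<^bsub>A\<^esub> b \<otimes>\<^bsub>A\<^esub> inv\<^bsub>A\<^esub> (s \<otimes>\<^bsub>A\<^esub> t \<otimes>\<^bsub>A\<^esub> w)) = w"
      if [simp]: "a \<in> carrier A" "b \<in> carrier A" "s \<in> carrier A" "t \<in> carrier A" "w \<in> carrier A" for a b s t w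
    proof -
      have "(a \<otimes>\<^bsub>A\<^esub> inv\<^bsub>A\<^esub> s) \<otimes>\<^bsub>A\<^esub> (b \<otimes>\<^bsub>A\<^esub> inv\<^bsub>A\<^esub> t) \<otimes>\<^bsub>A\<^esub> inv\<^bsub>A\<^esub> (a \<otimes>\<^bsub>A\<^esub> b \<otimes>\<^bsub>A\<^esub> inv\<^bsub>A\<^esub> (s \<otimes>\<^bsub>A\<^esub> t \<otimes>\<^bsub>A\<^esub> w)) =
          (a \<otimes>\<^bsub>A\<^esub> inv\<^bsub>A\<^esub> a) \<otimes>\<^bsub>A\<^esub> (b \<otimes>\<^bsub>A\<^esub> inv\<^bsub>A\<^esub> b) \<otimes>\<^bsub>A\<^esub> (s \<otimes>\<^bsub>A\<^esub> inv\<^bsub>A\<^esub> s) \<otimes>\<^bsub>A\<^esub> (t \<otimes>\<^bsub>A\<^esub> inv\<^bsub>A\<^esub> t) \<otimes>\<^bsub>A\<^esub> w"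
        by (simp add: A.inv_mult ac0)
      then show ?thesis by simp
    qed
    have "restrict \<alpha> (S \<times> S) = coboundary (G\<lparr>carrier := S\<rparr>) A c"
    proof (rule ext)
      fix q :: "'g \<times> 'g"
      obtain x y where q: "q = (x, y)" by fastforce
      show "restrict \<alpha> (S \<times> S) q = coboundary (G\<lparr>carrier := S\<rparr>) A c q"
      proof (cases "x \<in> S \<and> y \<in> S")
        case True
        then have xy: "x \<in> carrier G" "y \<in> carrier G" by auto
        obtain u where [simp]: "u \<in> carrier F" and x: "x = p u" using xy(1) by (rule lift_exists)
        obtain v where [simp]: "v \<in> carrier F" and y: "y = p v" using xy(2) by (rule lift_exists)
        note s = x y
        have [simp]: "p u \<in> S" "p v \<in> S" using True s by auto
        have "c x \<otimes>\<^bsub>A\<^esub> c y \<otimes>\<^bsub>A\<^esub> inv\<^bsub>A\<^esub> c (x \<otimes>\<^bsub>G\<^esub> y) = \<alpha> (x, y)"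
          using c[of "u \<otimes>\<^bsub>F\<^esub> v"] c\<alpha>[of x y] by (simp add: s c \<psi>m triv_mult ac)
        then show ?thesis using True by (simp add: q)
      qed (auto simp: q)
    qed
    moreover have "c \<in> S \<rightarrow> carrier A" using m by (auto simp: c_def)
    ultimately show ?lhs unfolding B2_iff by auto
  }
qed

lemma B2_iff_extends:
  "\<alpha> \<in> B2 G A \<longleftrightarrow> (\<exists>\<psi>\<in>hom F A. \<forall>r\<in>R. \<psi> r = kernel_char \<phi> r)"
proof -
  have "restrict \<alpha> (carrier G \<times> carrier G) = \<alpha>" using \<alpha> by (simp add: C2_def PiE_restrict)
  moreover have "{u \<in> carrier F. p u \<in> carrier G} = carrier F" by auto
  ultimately show ?thesis
    using restrict_in_B2_iff_extends[OF G.subgroup_self] by simp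
qed

text \<open>A commutator [x,y] lies in \<open>R\<close> iff the images of x and y commute, that is,
  lie in a common abelian \<open>S\<close>; an extension of the character to the preimage of
  \<open>S\<close> kills it because \<open>A\<close> is commutative. Conversely, the commutators of
  the preimage of an abelian \<open>S\<close> lie in \<open>R\<close>, so a character trivial on
  them extends by \<open>hom_extension\<close>.\<close>

lemma locally_coboundary_iff:
  assumes A: "divisible_group A"
  shows "(\<forall>S. subgroup S G \<longrightarrow> comm_group (G\<lparr>carrier := S\<rparr>) \<longrightarrow>
       restrict \<alpha> (S \<times> S) \<in> B2 (G\<lparr>carrier := S\<rparr>) A) \<longleftrightarrow>
    (\<forall>k\<in>commutators F \<inter> R. kernel_char \<phi> k = \<one>\<^bsub>A\<^esub>)" (is "?lhs \<longleftrightarrow> ?rhs")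
proof (intro iffI ballI allI impI)
  fix k assume L: ?lhs and k: "k \<in> commutators F \<inter> R"
  then obtain x y where [simp]: "x \<in> carrier F" "y \<in> carrier F"
    and kxy: "k = inv\<^bsub>F\<^esub> x \<otimes>\<^bsub>F\<^esub> inv\<^bsub>F\<^esub> y \<otimes>\<^bsub>F\<^esub> x \<otimes>\<^bsub>F\<^esub> y"
    by (auto simp: commutators_def)
  have "inv\<^bsub>G\<^esub> p x \<otimes>\<^bsub>G\<^esub> inv\<^bsub>G\<^esub> p y \<otimes>\<^bsub>G\<^esub> p x \<otimes>\<^bsub>G\<^esub> p y = \<one>\<^bsub>G\<^esub>"
    using k by (simp add: R_iff kxy)
  then have "inv\<^bsub>G\<^esub> (p y \<otimes>\<^bsub>G\<^esub> p x) \<otimes>\<^bsub>G\<^esub> (p x \<otimes>\<^bsub>G\<^esub> p y) = \<one>\<^bsub>G\<^esub>"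
    by (simp add: G.inv_mult_group G.m_assoc)
  then have "p x \<otimes>\<^bsub>G\<^esub> p y = p y \<otimes>\<^bsub>G\<^esub> p x"
    by (metis G.inv_solve_left' G.m_closed G.one_closed G.r_one \<open>x \<in> carrier F\<close> \<open>y \<in> carrier F\<close> p.hom_closed)
  then obtain S where S: "subgroup S G" "comm_group (G\<lparr>carrier := S\<rparr>)" and [simp]: "p x \<in> S" "p y \<in> S"
    using G.commuting_in_abelian_subgroup[of "p x" "p y"] by auto
  then obtain \<psi> where \<psi>: "\<psi> \<in> hom (F\<lparr>carrier := {u \<in> carrier F. p u \<in> S}\<rparr>) A"
      and \<psi>R: "\<And>r. r \<in> R \<Longrightarrow> \<psi> r = kernel_char \<phi> r"
    using L restrict_in_B2_iff_extends[OF S(1)] by blast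
  interpret S: subgroup S G by (rule S(1))
  have \<psi>m: "\<psi> (u \<otimes>\<^bsub>F\<^esub> v) = \<psi> u \<otimes>\<^bsub>A\<^esub> \<psi> v"
    if "u \<in> carrier F" "p u \<in> S" "v \<in> carrier F" "p v \<in> S" for u v
    using hom_mult[OF \<psi>] that by simp
  have [simp]: "\<psi> x \<in> carrier A" "\<psi> y \<in> carrier A" "\<psi> k \<in> carrier A"
    using hom_in_carrier[OF \<psi>] k by (auto simp: R_iff)
  \<comment> \<open>The commutator relation is rewritten as y x k = x y, so that \<psi> can be
    applied without inverses and \<psi>(k) cancels out.\<close>
  have "k = inv\<^bsub>F\<^esub> (y \<otimes>\<^bsub>F\<^esub> x) \<otimes>\<^bsub>F\<^esub> (x \<otimes>\<^bsub>F\<^esub> y)"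
    by (simp add: kxy p.G.inv_mult_group p.G.m_assoc)
  then have "y \<otimes>\<^bsub>F\<^esub> x \<otimes>\<^bsub>F\<^esub> k = x \<otimes>\<^bsub>F\<^esub> y"
    by (simp add: p.G.m_assoc[symmetric] del: p.G.inv_mult_group)
  then have "\<psi> y \<otimes>\<^bsub>A\<^esub> \<psi> x \<otimes>\<^bsub>A\<^esub> \<psi> k = \<psi> x \<otimes>\<^bsub>A\<^esub> \<psi> y"
    using k \<psi>m[of "y \<otimes>\<^bsub>F\<^esub> x" k] by (simp add: \<psi>m R_iff)
  then have "\<psi> k = \<one>\<^bsub>A\<^esub>" by (simp add: A.m_comm[of "\<psi> y" "\<psi> x"])
  then show "kernel_char \<phi> k = \<one>\<^bsub>A\<^esub>" using \<psi>R k by simp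
next
  fix S assume triv_comm: ?rhs and S: "subgroup S G" and comm: "comm_group (G\<lparr>carrier := S\<rparr>)"
  interpret S: subgroup S G by fact
  interpret SC: comm_group "G\<lparr>carrier := S\<rparr>" by fact
  define K where "K = {u \<in> carrier F. p u \<in> S}"
  have K: "subgroup K F"
    by (rule p.G.subgroupI) (auto simp: K_def intro!: exI[of _ "\<one>\<^bsub>F\<^esub>"])
  have RK: "R \<subseteq> K" by (auto simp: K_def R_iff)
  have RsubK: "subgroup R (F\<lparr>carrier := K\<rparr>)"
    by (rule p.G.subgroup_incl[OF subgroup_R K RK])
  have "derived_set F K \<subseteq> commutators F \<inter> R"
  proof (rule Int_greatest)
    show "derived_set F K \<subseteq> commutators F"
      by (rule p.G.derived_set_subset_commutators) (auto simp: K_def)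
    show "derived_set F K \<subseteq> R"
    proof
      fix g assume "g \<in> derived_set F K"
      then obtain h k where [simp]: "h \<in> carrier F" "k \<in> carrier F" and hk: "p h \<in> S" "p k \<in> S"
        and g: "g = h \<otimes>\<^bsub>F\<^esub> k \<otimes>\<^bsub>F\<^esub> inv\<^bsub>F\<^esub> h \<otimes>\<^bsub>F\<^esub> inv\<^bsub>F\<^esub> k" by (auto simp: K_def)
      have "p h \<otimes>\<^bsub>G\<^esub> p k = p k \<otimes>\<^bsub>G\<^esub> p h" using SC.m_comm[of "p h" "p k"] hk by simp
      then have "p g = p k \<otimes>\<^bsub>G\<^esub> p h \<otimes>\<^bsub>G\<^esub> inv\<^bsub>G\<^esub> p h \<otimes>\<^bsub>G\<^esub> inv\<^bsub>G\<^esub> p k" by (simp add: g)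
      also have "\<dots> = \<one>\<^bsub>G\<^esub>" by (simp add: G.m_assoc)
      finally show "g \<in> R" by (simp add: R_iff g)
    qed
  qed
  then have der: "derived F K \<subseteq> generate F (commutators F \<inter> R)"
    unfolding derived_def by (rule p.G.mono_generate)
  have K': "derived (F\<lparr>carrier := K\<rparr>) K = derived F K"
    by (rule p.G.derived_consistent[OF _ K]) simp
  have t: "kernel_char \<phi> h = \<one>\<^bsub>A\<^esub>" if "h \<in> derived (F\<lparr>carrier := K\<rparr>) K" for h
  proof (rule p.G.hom_trivial_on_generate[OF subgroup_R A.is_group kernel_char_hom])
    show "h \<in> generate F (commutators F \<inter> R)" using that der K' by auto
  qed (use triv_comm in auto)
  \<comment> \<open>\<open>hom_extension\<close> is applied inside \<open>K\<close>, where
    \<open>R\<close> is a subgroup of a group that already has an updated carrier.\<close>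
  have "kernel_char \<phi> \<in> hom (F\<lparr>carrier := K, carrier := R\<rparr>) A"
    using kernel_char_hom by simp
  then obtain \<psi> where "\<psi> \<in> hom (F\<lparr>carrier := K\<rparr>) A" "\<And>h. h \<in> R \<Longrightarrow> \<psi> h = kernel_char \<phi> h"
    by (rule hom_extension[OF p.G.subgroup_imp_group[OF K] A RsubK]) (simp_all add: t)
  then show "restrict \<alpha> (S \<times> S) \<in> B2 (G\<lparr>carrier := S\<rparr>) A"
    unfolding restrict_in_B2_iff_extends[OF S] K_def by blast
qed

end

end

section \<open>Comparing classes through their characters on the kernel\<close>

context cover
begin

lemma trivializes_mult:
  assumes "trivializes F p A \<phi> \<alpha>" "\<alpha> \<in> carrier (C2 G A)"
    and "trivializes F p A \<psi> \<beta>" "\<beta> \<in> carrier (C2 G A)"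
  shows "trivializes F p A (\<lambda>u. \<phi> u \<otimes>\<^bsub>A\<^esub> \<psi> u) (\<alpha> \<otimes>\<^bsub>C2 G A\<^esub> \<beta>)"
  unfolding trivializes_def
proof (intro conjI ballI)
  note [simp] = triv_closed[OF assms(1,2)] triv_closed[OF assms(3,4)]
    C2_closed[OF assms(2)] C2_closed[OF assms(4)]
  show "(\<lambda>u. \<phi> u \<otimes>\<^bsub>A\<^esub> \<psi> u) \<in> carrier F \<rightarrow> carrier A" by auto
  fix u v assume "u \<in> carrier F" "v \<in> carrier F"
  then show "\<phi> (u \<otimes>\<^bsub>F\<^esub> v) \<otimes>\<^bsub>A\<^esub> \<psi> (u \<otimes>\<^bsub>F\<^esub> v) =
      \<phi> u \<otimes>\<^bsub>A\<^esub> \<psi> u \<otimes>\<^bsub>A\<^esub> (\<phi> v \<otimes>\<^bsub>A\<^esub> \<psi> v) \<otimes>\<^bsub>A\<^esub> (\<alpha> \<otimes>\<^bsub>C2 G A\<^esub> \<beta>) (p u, p v)"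
    by (simp add: triv_mult[OF assms(1,2)] triv_mult[OF assms(3,4)] C2_mult A.m_swap6)
qed

lemma trivializes_inv:
  assumes "trivializes F p A \<phi> \<alpha>" "\<alpha> \<in> carrier (C2 G A)"
  shows "trivializes F p A (\<lambda>u. inv\<^bsub>A\<^esub> \<phi> u) (inv\<^bsub>C2 G A\<^esub> \<alpha>)"
  using triv_closed[OF assms] triv_mult[OF assms] C2_closed[OF assms(2)]
  by (auto simp: trivializes_def C2_inv[OF assms(2)] A.inv_mult)

lemma kernel_char_mult:
  assumes "\<phi> r \<in> carrier A" "\<psi> r \<in> carrier A" "\<phi> \<one>\<^bsub>F\<^esub> \<in> carrier A" "\<psi> \<one>\<^bsub>F\<^esub> \<in> carrier A"
  shows "kernel_char (\<lambda>u. \<phi> u \<otimes>\<^bsub>A\<^esub> \<psi> u) r = kernel_char \<phi> r \<otimes>\<^bsub>A\<^esub> kernel_char \<psi> r"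
  using assms by (simp add: A.inv_mult A.m_swap4)

text \<open>The quotient of the two cochains is trivialized by the quotient of \<phi> and \<psi>,
  whose character on \<open>R\<close> is trivial. The constant homomorphism on \<open>F\<close>
  extends that character, so the quotient is a coboundary.\<close>

lemma H2_class_eqI:
  assumes \<phi>: "trivializes F p A \<phi> \<alpha>" "\<alpha> \<in> carrier (C2 G A)"
    and \<psi>: "trivializes F p A \<psi> \<beta>" "\<beta> \<in> carrier (C2 G A)"
    and eq: "\<And>r. r \<in> R \<Longrightarrow> kernel_char \<phi> r = kernel_char \<psi> r"
  shows "H2_class G A \<alpha> = H2_class G A \<beta>"
proof -
  interpret H2: comm_group "H2 G A" by (rule comm_group_H2)
  interpret cl: group_hom "Z2_group G A" "H2 G A" "H2_class G A"
    using H2_class_hom by (simp add: group_hom_def group_hom_axioms_def Z2.is_group H2.is_group)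
  have Z: "\<alpha> \<in> Z2 G A" "\<beta> \<in> Z2 G A" using triv_Z2[OF \<phi>] triv_Z2[OF \<psi>] by auto
  let ?\<psi>' = "\<lambda>u. inv\<^bsub>A\<^esub> \<psi> u" and ?\<beta>' = "inv\<^bsub>C2 G A\<^esub> \<beta>"
  have \<psi>': "trivializes F p A ?\<psi>' ?\<beta>'" "?\<beta>' \<in> carrier (C2 G A)"
    using trivializes_inv[OF \<psi>] \<psi>(2) by auto
  note closed = triv_closed[OF \<phi>] triv_closed[OF \<psi>]
  have "kernel_char (\<lambda>u. \<phi> u \<otimes>\<^bsub>A\<^esub> ?\<psi>' u) r = \<one>\<^bsub>A\<^esub>" if r: "r \<in> R" for r
  proof -
    have rF: "r \<in> carrier F" using r by (simp add: R_iff)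
    have "kernel_char (\<lambda>u. \<phi> u \<otimes>\<^bsub>A\<^esub> ?\<psi>' u) r = kernel_char \<phi> r \<otimes>\<^bsub>A\<^esub> kernel_char ?\<psi>' r"
      using closed rF by (intro kernel_char_mult) auto
    also have "kernel_char ?\<psi>' r = inv\<^bsub>A\<^esub> kernel_char \<psi> r"
      using closed rF by (simp add: A.inv_mult)
    finally show ?thesis using closed rF eq[OF r] by simp
  qed
  moreover have "(\<lambda>u. \<one>\<^bsub>A\<^esub>) \<in> hom F A" by (auto simp: hom_def)
  ultimately have "\<alpha> \<otimes>\<^bsub>C2 G A\<^esub> ?\<beta>' \<in> B2 G A"
    using B2_iff_extends[OF trivializes_mult[OF \<phi> \<psi>']] \<phi>(2) \<psi>(2) by force
  moreover have "?\<beta>' = inv\<^bsub>Z2_group G A\<^esub> \<beta>"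
    using Z(2) by (simp add: C2.m_inv_consistent[OF subgroup_Z2])
  moreover have "\<alpha> \<otimes>\<^bsub>C2 G A\<^esub> ?\<beta>' \<in> Z2 G A"
    using Z subgroup_Z2 by (simp add: subgroup.m_closed subgroup.m_inv_closed)
  ultimately have "H2_class G A (\<alpha> \<otimes>\<^bsub>Z2_group G A\<^esub> inv\<^bsub>Z2_group G A\<^esub> \<beta>) = \<one>\<^bsub>H2 G A\<^esub>"
    using H2_class_eq_one_iff by simp
  moreover have "\<alpha> \<in> carrier (Z2_group G A)" "\<beta> \<in> carrier (Z2_group G A)" using Z by auto
  ultimately have "H2_class G A \<alpha> \<otimes>\<^bsub>H2 G A\<^esub> inv\<^bsub>H2 G A\<^esub> H2_class G A \<beta> = \<one>\<^bsub>H2 G A\<^esub>"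
    by (metis cl.hom_inv cl.hom_mult Z2.inv_closed)
  moreover have "H2_class G A \<alpha> \<in> carrier (H2 G A)" "H2_class G A \<beta> \<in> carrier (H2 G A)"
    using Z by (auto simp: carrier_H2)
  ultimately show ?thesis by (metis H2.inv_equality H2.inv_inv H2.inv_closed)
qed

text \<open>The transgression cocycle computed with representatives in \<open>F\<close>. It is
  trivialized by applying \<chi> to the discrepancy between \<open>u\<close> and the chosen lift of
  \<open>p u\<close>, and the resulting character is \<chi> itself. Invariance of \<chi> under
  conjugation replaces centrality of the kernel.\<close>

lemma section_cochain_trivialized:
  fixes \<chi> m
  defines "\<alpha> \<equiv> (\<lambda>(x, y)\<in>carrier G \<times> carrier G.
      \<chi> (m x \<otimes>\<^bsub>F\<^esub> m y \<otimes>\<^bsub>F\<^esub> inv\<^bsub>F\<^esub> m (x \<otimes>\<^bsub>G\<^esub> y)))"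
    and "\<phi> \<equiv> \<lambda>u. \<chi> (u \<otimes>\<^bsub>F\<^esub> inv\<^bsub>F\<^esub> m (p u))"
  assumes \<chi>: "\<chi> \<in> hom (F\<lparr>carrier := R\<rparr>) A"
    and central: "\<And>u r. u \<in> carrier F \<Longrightarrow> r \<in> R \<Longrightarrow> \<chi> (u \<otimes>\<^bsub>F\<^esub> r \<otimes>\<^bsub>F\<^esub> inv\<^bsub>F\<^esub> u) = \<chi> r"
    and m: "\<And>x. x \<in> carrier G \<Longrightarrow> m x \<in> carrier F" "\<And>x. x \<in> carrier G \<Longrightarrow> p (m x) = x"
  shows "\<alpha> \<in> carrier (C2 G A)" "trivializes F p A \<phi> \<alpha>" "\<And>r. r \<in> R \<Longrightarrow> kernel_char \<phi> r = \<chi> r"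
proof -
  note [simp] = m
  have R1: "m x \<otimes>\<^bsub>F\<^esub> m y \<otimes>\<^bsub>F\<^esub> inv\<^bsub>F\<^esub> m (x \<otimes>\<^bsub>G\<^esub> y) \<in> R" if "x \<in> carrier G" "y \<in> carrier G" for x y
    using that by (simp add: R_iff)
  have R2: "u \<otimes>\<^bsub>F\<^esub> inv\<^bsub>F\<^esub> m (p u) \<in> R" if "u \<in> carrier F" for u
    using that by (simp add: R_iff)
  have \<chi>m: "\<chi> (r \<otimes>\<^bsub>F\<^esub> s) = \<chi> r \<otimes>\<^bsub>A\<^esub> \<chi> s" if "r \<in> R" "s \<in> R" for r s
    using hom_mult[OF \<chi>] that by simp
  have \<chi>c: "\<chi> r \<in> carrier A" if "r \<in> R" for r
    using hom_in_carrier[OF \<chi>] that by simp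
  show "\<alpha> \<in> carrier (C2 G A)" using \<chi>c R1 by (auto simp: \<alpha>_def C2_def)
  show "trivializes F p A \<phi> \<alpha>"
    unfolding trivializes_def
  proof (intro conjI ballI)
    show "\<phi> \<in> carrier F \<rightarrow> carrier A" using \<chi>c R2 by (auto simp: \<phi>_def)
    fix u v assume u [simp]: "u \<in> carrier F" and v [simp]: "v \<in> carrier F"
    define a b w where "a = m (p u)" and "b = m (p v)" and "w = m (p (u \<otimes>\<^bsub>F\<^esub> v))"
    have [simp]: "a \<in> carrier F" "b \<in> carrier F" "w \<in> carrier F" by (simp_all add: a_def b_def w_def)
    let ?r = "u \<otimes>\<^bsub>F\<^esub> inv\<^bsub>F\<^esub> a" and ?s = "v \<otimes>\<^bsub>F\<^esub> inv\<^bsub>F\<^esub> b" and ?t = "a \<otimes>\<^bsub>F\<^esub> b \<otimes>\<^bsub>F\<^esub> inv\<^bsub>F\<^esub> w"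
    have rs: "?r \<in> R" "?s \<in> R" using R2 u v by (auto simp: a_def b_def)
    have t: "?t \<in> R" using R1[of "p u" "p v"] by (simp add: a_def b_def w_def)
    have s': "a \<otimes>\<^bsub>F\<^esub> ?s \<otimes>\<^bsub>F\<^esub> inv\<^bsub>F\<^esub> a \<in> R" using rs(2) by (simp add: R_iff)
    have "inv\<^bsub>F\<^esub> a \<otimes>\<^bsub>F\<^esub> (a \<otimes>\<^bsub>F\<^esub> z) = z" "inv\<^bsub>F\<^esub> b \<otimes>\<^bsub>F\<^esub> (b \<otimes>\<^bsub>F\<^esub> z) = z" if "z \<in> carrier F" for z
      using that by (simp_all flip: p.G.m_assoc)
    \<comment> \<open>Moving the discrepancy of \<open>v\<close> past \<open>a\<close> conjugates
      it; \<chi> does not see the conjugation, which leaves the three expected factors.\<close>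
    then have "u \<otimes>\<^bsub>F\<^esub> v \<otimes>\<^bsub>F\<^esub> inv\<^bsub>F\<^esub> w = ?r \<otimes>\<^bsub>F\<^esub> (a \<otimes>\<^bsub>F\<^esub> ?s \<otimes>\<^bsub>F\<^esub> inv\<^bsub>F\<^esub> a) \<otimes>\<^bsub>F\<^esub> ?t"
      by (simp add: p.G.m_assoc)
    then have "\<phi> (u \<otimes>\<^bsub>F\<^esub> v) = \<chi> ?r \<otimes>\<^bsub>A\<^esub> \<chi> (a \<otimes>\<^bsub>F\<^esub> ?s \<otimes>\<^bsub>F\<^esub> inv\<^bsub>F\<^esub> a) \<otimes>\<^bsub>A\<^esub> \<chi> ?t"
      using \<chi>m rs s' t subgroup.m_closed[OF p.subgroup_kernel rs(1) s'] by (simp add: \<phi>_def w_def)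
    also have "\<dots> = \<chi> ?r \<otimes>\<^bsub>A\<^esub> \<chi> ?s \<otimes>\<^bsub>A\<^esub> \<chi> ?t" using central[of a ?s] rs by simp
    finally show "\<phi> (u \<otimes>\<^bsub>F\<^esub> v) = \<phi> u \<otimes>\<^bsub>A\<^esub> \<phi> v \<otimes>\<^bsub>A\<^esub> \<alpha> (p u, p v)"
      by (simp add: \<phi>_def \<alpha>_def a_def b_def w_def)
  qed
  show "kernel_char \<phi> r = \<chi> r" if r: "r \<in> R" for r
  proof -
    \<comment> \<open>The section need not send 1 to 1. Its value there contributes the same factor
      to \<phi>(r) and to \<phi>(1), and \<open>kernel_char\<close> removes it.\<close>
    let ?e = "inv\<^bsub>F\<^esub> m \<one>\<^bsub>G\<^esub>"
    have e: "?e \<in> R" by (simp add: R_iff)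
    then have "\<phi> r = \<chi> r \<otimes>\<^bsub>A\<^esub> \<chi> ?e" "\<phi> \<one>\<^bsub>F\<^esub> = \<chi> ?e"
      using r \<chi>m[OF r e] by (simp_all add: \<phi>_def R_iff)
    then show ?thesis using \<chi>c[OF r] \<chi>c[OF e] by (simp add: A.m_assoc)
  qed
qed

end

section \<open>Groups of homomorphisms\<close>

lemma comm_group_Hom_group:
  assumes "group M" "comm_group A"
  shows "comm_group (Hom_group M A)"
proof -
  interpret M: group M by fact
  interpret A: comm_group A by fact
  let ?P = "product_group (carrier M) (\<lambda>_. A)"
  interpret P: group ?P by (simp add: A.is_group)
  have P: "comm_group ?P"
    by (rule P.group_comm_groupI) (auto simp: PiE_iff A.m_comm intro!: restrict_ext)
  have "subgroup (hom M A \<inter> extensional (carrier M)) ?P"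
  proof (rule P.subgroupI)
    show "hom M A \<inter> extensional (carrier M) \<subseteq> carrier ?P" by (auto simp: hom_def PiE_def)
    have "(\<lambda>x\<in>carrier M. \<one>\<^bsub>A\<^esub>) \<in> hom M A \<inter> extensional (carrier M)" by (auto simp: hom_def)
    then show "hom M A \<inter> extensional (carrier M) \<noteq> {}" by blast
    fix f g assume f: "f \<in> hom M A \<inter> extensional (carrier M)"
    then have fP: "f \<in> (\<Pi>\<^sub>E i\<in>carrier M. carrier A)" by (auto simp: hom_def PiE_def)
    show "inv\<^bsub>?P\<^esub> f \<in> hom M A \<inter> extensional (carrier M)"
      using f fP by (auto simp: hom_def A.inv_mult A.is_group Pi_iff)
    assume g: "g \<in> hom M A \<inter> extensional (carrier M)"
    show "f \<otimes>\<^bsub>?P\<^esub> g \<in> hom M A \<inter> extensional (carrier M)"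
      using f g by (auto simp: hom_def Pi_iff A.m_swap4)
  qed
  then show ?thesis
    unfolding Hom_group_def by (rule comm_group.comm_group_subgroup[OF P])
qed

lemma carrier_Hom_group: "carrier (Hom_group M A) = hom M A \<inter> extensional (carrier M)"
  by (simp add: Hom_group_def)

lemma mult_Hom_group: "\<chi> \<otimes>\<^bsub>Hom_group M A\<^esub> \<psi> = (\<lambda>x\<in>carrier M. \<chi> x \<otimes>\<^bsub>A\<^esub> \<psi> x)"
  by (simp add: Hom_group_def)

lemma one_Hom_group: "\<one>\<^bsub>Hom_group M A\<^esub> = (\<lambda>x\<in>carrier M. \<one>\<^bsub>A\<^esub>)"
  by (simp add: Hom_group_def)

lemma Hom_group_inflate:
  assumes "N \<lhd> H" and \<chi>: "\<chi> \<in> carrier (Hom_group (H Mod N) A)"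
  shows "(\<lambda>h. \<chi> (N #>\<^bsub>H\<^esub> h)) \<in> hom H A"
  using hom_compose[OF normal.r_coset_hom_Mod[OF assms(1)], of \<chi> A] \<chi>
  by (simp add: carrier_Hom_group comp_def)

lemma Hom_group_factor:
  assumes N: "N \<lhd> H" and "group A" and \<chi>: "\<chi> \<in> hom H A" and "\<And>n. n \<in> N \<Longrightarrow> \<chi> n = \<one>\<^bsub>A\<^esub>"
  obtains \<chi>' where "\<chi>' \<in> carrier (Hom_group (H Mod N) A)"
    "\<And>h. h \<in> carrier H \<Longrightarrow> \<chi>' (N #>\<^bsub>H\<^esub> h) = \<chi> h"
proof -
  interpret N: normal N H by fact
  interpret \<chi>: group_hom H A \<chi>
    using \<chi> assms(2) by (simp add: group_hom_def group_hom_axioms_def N.is_group)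
  have "N \<subseteq> kernel H A \<chi>" using assms(4) N.subset by (auto simp: kernel_def)
  then obtain g where g: "g \<in> hom (H Mod N) A" "\<And>h. h \<in> carrier H \<Longrightarrow> g (N #>\<^bsub>H\<^esub> h) = \<chi> h"
    using \<chi>.FactGroup_universal_kernel[OF N] by blast
  interpret Q: group "H Mod N" by (rule N.factorgroup_is_group)
  have "restrict g (carrier (H Mod N)) \<in> carrier (Hom_group (H Mod N) A)"
    using g(1) Q.m_closed by (auto simp: carrier_Hom_group hom_def)
  moreover have "restrict g (carrier (H Mod N)) (N #>\<^bsub>H\<^esub> h) = \<chi> h" if "h \<in> carrier H" for h
    using g(2) that by (auto simp: carrier_FactGroup)
  ultimately show thesis by (rule that)
qed

text \<open>By the first isomorphism theorem both targets are isomorphic to \<open>H\<close> modulo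
  the common kernel. This will compare transgression with restriction of characters.\<close>

lemma iso_of_epi_same_kernel:
  assumes "group H" "group K" "group L" and f: "f \<in> epi H K" and g: "g \<in> epi H L"
    and ker: "\<And>x. x \<in> carrier H \<Longrightarrow> f x = \<one>\<^bsub>K\<^esub> \<longleftrightarrow> g x = \<one>\<^bsub>L\<^esub>"
  shows "K \<cong> L"
proof -
  interpret f: group_hom H K f
    using assms by (simp add: group_hom_def group_hom_axioms_def epi_def)
  interpret g: group_hom H L g
    using assms by (simp add: group_hom_def group_hom_axioms_def epi_def)
  have "kernel H K f = kernel H L g" using ker by (auto simp: kernel_def)
  moreover have "H Mod kernel H K f \<cong> K" using f by (intro f.FactGroup_iso) (simp add: epi_def)
  moreover have "H Mod kernel H L g \<cong> L" using g by (intro g.FactGroup_iso) (simp add: epi_def)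
  moreover have "group (H Mod kernel H K f)" by (rule normal.factorgroup_is_group[OF f.normal_kernel])
  ultimately show ?thesis by (metis group.iso_sym iso_trans)
qed

lemma (in group) hom_trivial_on_derived:
  assumes "comm_group A" "\<psi> \<in> hom G A" "x \<in> derived G (carrier G)"
  shows "\<psi> x = \<one>\<^bsub>A\<^esub>"
proof -
  interpret A: comm_group A by fact
  interpret \<psi>: group_hom G A \<psi>
    using assms by (simp add: group_hom_def group_hom_axioms_def is_group A.is_group)
  have "\<psi> ` derived G (carrier G) = derived A (\<psi> ` carrier G)"
    by (simp add: \<psi>.derived_img)
  also have "\<dots> = {\<one>\<^bsub>A\<^esub>}" by (rule A.derived_eq_singleton) auto
  finally show ?thesis using assms(3) by blast
qed

lemma (in group) commutators_subset_derived: "commutators G \<subseteq> derived G (carrier G)"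
proof
  fix k assume "k \<in> commutators G"
  then obtain x y where [simp]: "x \<in> carrier G" "y \<in> carrier G"
    and k: "k = inv x \<otimes> inv y \<otimes> x \<otimes> y" by (auto simp: commutators_def)
  have "inv x \<otimes> inv y \<otimes> inv (inv x) \<otimes> inv (inv y) \<in> derived_set G (carrier G)"
    by (intro UN_I[of "inv x"] UN_I[of "inv y"]) auto
  then show "k \<in> derived G (carrier G)" unfolding derived_def k by (auto intro: generate.incl)
qed

section \<open>Transgression\<close>

locale presentation =
  fixes F :: "('a, 'm) monoid_scheme" and R N :: "'a set"
  assumes R_normal: "R \<lhd> F" and N_eq: "N = generate F (commutators F \<inter> R)"
begin

sublocale R: normal R F by (rule R_normal)

abbreviation "F' \<equiv> derived F (carrier F)"
abbreviation "M \<equiv> F\<lparr>carrier := R\<rparr> Mod N"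
abbreviation "D \<equiv> F\<lparr>carrier := F' \<inter> R\<rparr> Mod N"

lemma comm_group_QZ: "comm_group QZ"
  using divisible_QZ by (simp add: divisible_group_def)

sublocale QZ: comm_group QZ by (rule comm_group_QZ)

lemma group_G: "group (F Mod R)"
  by (rule R.factorgroup_is_group)

sublocale cov: cover F "F Mod R" QZ "\<lambda>u. R #>\<^bsub>F\<^esub> u"
proof -
  have "group_hom F (F Mod R) (\<lambda>u. R #>\<^bsub>F\<^esub> u)"
    using R.r_coset_hom_Mod group_G by (simp add: group_hom_def group_hom_axioms_def R.is_group)
  then show "cover F (F Mod R) QZ (\<lambda>u. R #>\<^bsub>F\<^esub> u)"
    using group_G comm_group_QZ
    by (simp add: cover_def cover_axioms_def cohomology_def carrier_FactGroup)
qed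

lemma kernel_eq: "kernel F (F Mod R) (\<lambda>u. R #>\<^bsub>F\<^esub> u) = R"
proof (intro equalityI subsetI)
  fix r assume "r \<in> kernel F (F Mod R) (\<lambda>u. R #>\<^bsub>F\<^esub> u)"
  then show "r \<in> R" by (intro R.coset_join1[OF _ _ R.subgroup_axioms]) (simp_all add: kernel_def)
next
  fix r assume "r \<in> R"
  then show "r \<in> kernel F (F Mod R) (\<lambda>u. R #>\<^bsub>F\<^esub> u)"
    using R.coset_join2[OF _ R.subgroup_axioms] by (simp add: kernel_def)
qed

lemma N_incl: "k \<in> commutators F \<Longrightarrow> k \<in> R \<Longrightarrow> k \<in> N"
  by (simp add: N_eq generate.incl)

lemma N_subset_R: "N \<subseteq> R"
  unfolding N_eq by (rule R.generate_subgroup_incl[OF _ R.subgroup_axioms]) simp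

text \<open>Conjugation is an automorphism, so it maps commutators to commutators, and it preserves
  \<open>R\<close>; the generating set is thus closed under it.\<close>

lemma N_normal: "N \<lhd> F"
  unfolding N_eq
proof (rule R.normal_generateI)
  show "commutators F \<inter> R \<subseteq> carrier F" using R.subset by blast
  fix h g assume h: "h \<in> commutators F \<inter> R" and g [simp]: "g \<in> carrier F"
  then obtain x y where [simp]: "x \<in> carrier F" "y \<in> carrier F"
    and hxy: "h = inv\<^bsub>F\<^esub> x \<otimes>\<^bsub>F\<^esub> inv\<^bsub>F\<^esub> y \<otimes>\<^bsub>F\<^esub> x \<otimes>\<^bsub>F\<^esub> y" by (auto simp: commutators_def)
  let ?c = "\<lambda>u. g \<otimes>\<^bsub>F\<^esub> u \<otimes>\<^bsub>F\<^esub> inv\<^bsub>F\<^esub> g"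
  have "inv\<^bsub>F\<^esub> g \<otimes>\<^bsub>F\<^esub> (g \<otimes>\<^bsub>F\<^esub> z) = z" if "z \<in> carrier F" for z
    using that by (simp flip: R.m_assoc)
  then have "?c h = inv\<^bsub>F\<^esub> ?c x \<otimes>\<^bsub>F\<^esub> inv\<^bsub>F\<^esub> ?c y \<otimes>\<^bsub>F\<^esub> ?c x \<otimes>\<^bsub>F\<^esub> ?c y"
    by (simp add: hxy R.m_assoc R.inv_mult_group)
  moreover have "?c x \<in> carrier F" "?c y \<in> carrier F" by simp_all
  ultimately have "?c h \<in> commutators F" unfolding commutators_def by blast
  then show "?c h \<in> commutators F \<inter> R" using h g R.inv_op_closed2 by blast
qed

sublocale N: normal N F by (rule N_normal)

lemma N_subset_derived: "N \<subseteq> F'"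
  unfolding N_eq
  using R.commutators_subset_derived
  by (intro R.generate_subgroup_incl[OF _ R.derived_is_subgroup]) auto

lemma subgroup_D: "subgroup (F' \<inter> R) F"
  by (rule R.subgroups_Inter_pair[OF R.derived_is_subgroup R.subgroup_axioms]) simp

lemma N_normal_R: "N \<lhd> F\<lparr>carrier := R\<rparr>"
  by (rule R.normal_restrict_supergroup[OF R.subgroup_axioms N_normal N_subset_R])

lemma N_normal_D: "N \<lhd> F\<lparr>carrier := F' \<inter> R\<rparr>"
  using N_subset_R N_subset_derived
  by (intro R.normal_restrict_supergroup[OF subgroup_D N_normal]) auto

lemma coset_restrict: "N #>\<^bsub>F\<lparr>carrier := H\<rparr>\<^esub> h = N #>\<^bsub>F\<^esub> h"
  by (simp add: r_coset_def)

lemma carrier_M: "carrier M = (\<lambda>r. N #>\<^bsub>F\<^esub> r) ` R"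
  by (simp add: carrier_FactGroup coset_restrict)

lemma carrier_D: "carrier D = (\<lambda>r. N #>\<^bsub>F\<^esub> r) ` (F' \<inter> R)"
  by (simp add: carrier_FactGroup coset_restrict)

lemma coset_of_N: "n \<in> N \<Longrightarrow> N #>\<^bsub>F\<^esub> n = N"
  using R.coset_join2[OF N.mem_carrier N.subgroup_axioms] by blast

lemma Hom_M_inflate:
  assumes "\<chi> \<in> carrier (Hom_group M QZ)"
  shows "(\<lambda>r. \<chi> (N #>\<^bsub>F\<^esub> r)) \<in> hom (F\<lparr>carrier := R\<rparr>) QZ"
  using Hom_group_inflate[OF N_normal_R assms] by (simp add: coset_restrict)

lemma Hom_one:
  assumes "group K" "\<chi> \<in> carrier (Hom_group (K Mod N) QZ)" "N \<lhd> K"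
  shows "\<chi> N = \<one>\<^bsub>QZ\<^esub>"
  using hom_one[of \<chi> "K Mod N" QZ] assms normal.factorgroup_is_group[OF assms(3)]
  by (simp add: carrier_Hom_group QZ.is_group)

lemma Hom_M_trivial_on_N:
  assumes "\<chi> \<in> carrier (Hom_group M QZ)" "n \<in> N"
  shows "\<chi> (N #>\<^bsub>F\<^esub> n) = \<one>\<^bsub>QZ\<^esub>"
  using Hom_one[OF _ assms(1) N_normal_R] R.subgroup_imp_group[OF R.subgroup_axioms] assms(2)
  by (simp add: coset_of_N)

lemma Hom_M_factor:
  assumes "\<theta> \<in> hom (F\<lparr>carrier := R\<rparr>) QZ" "\<And>n. n \<in> N \<Longrightarrow> \<theta> n = \<one>\<^bsub>QZ\<^esub>"
  obtains \<chi> where "\<chi> \<in> carrier (Hom_group M QZ)" "\<And>r. r \<in> R \<Longrightarrow> \<chi> (N #>\<^bsub>F\<^esub> r) = \<theta> r"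
  using Hom_group_factor[OF N_normal_R QZ.is_group assms] unfolding coset_restrict by simp metis

text \<open>The commutator of \<open>u\<close> and \<open>r\<close> lies in \<open>R\<close> by
  normality, hence in \<open>N\<close>. This is centrality of \<open>M\<close> in
  \<open>F Mod N\<close>, seen through \<chi>.\<close>

lemma Hom_M_central:
  assumes \<chi>: "\<chi> \<in> carrier (Hom_group M QZ)" and u: "u \<in> carrier F" and r: "r \<in> R"
  shows "\<chi> (N #>\<^bsub>F\<^esub> (u \<otimes>\<^bsub>F\<^esub> r \<otimes>\<^bsub>F\<^esub> inv\<^bsub>F\<^esub> u)) = \<chi> (N #>\<^bsub>F\<^esub> r)"
proof -
  note h = Hom_M_inflate[OF \<chi>]
  have rF: "r \<in> carrier F" using r R.mem_carrier by blast
  let ?k = "u \<otimes>\<^bsub>F\<^esub> r \<otimes>\<^bsub>F\<^esub> inv\<^bsub>F\<^esub> u \<otimes>\<^bsub>F\<^esub> inv\<^bsub>F\<^esub> r"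
  have "?k = inv\<^bsub>F\<^esub> (inv\<^bsub>F\<^esub> u) \<otimes>\<^bsub>F\<^esub> inv\<^bsub>F\<^esub> (inv\<^bsub>F\<^esub> r) \<otimes>\<^bsub>F\<^esub> inv\<^bsub>F\<^esub> u \<otimes>\<^bsub>F\<^esub> inv\<^bsub>F\<^esub> r"
    using u rF by simp
  then have "?k \<in> commutators F" unfolding commutators_def using u rF by blast
  moreover have kR: "?k \<in> R" using R.inv_op_closed2[OF u r] r by simp
  ultimately have kN: "?k \<in> N" by (rule N_incl)
  have "u \<otimes>\<^bsub>F\<^esub> r \<otimes>\<^bsub>F\<^esub> inv\<^bsub>F\<^esub> u = ?k \<otimes>\<^bsub>F\<^esub> r" using u rF by (simp add: R.m_assoc)
  then have "\<chi> (N #>\<^bsub>F\<^esub> (u \<otimes>\<^bsub>F\<^esub> r \<otimes>\<^bsub>F\<^esub> inv\<^bsub>F\<^esub> u)) = \<chi> (N #>\<^bsub>F\<^esub> ?k) \<otimes>\<^bsub>QZ\<^esub> \<chi> (N #>\<^bsub>F\<^esub> r)"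
    using hom_mult[OF h, of ?k r] kR r by simp
  then show ?thesis
    using Hom_M_trivial_on_N[OF \<chi> kN] hom_in_carrier[OF h, of r] r by simp
qed

text \<open>Choosing representatives of the values of \<mu> gives a section of \<open>F\<close> over
  \<open>F Mod R\<close>, and \<chi> pulls back to a conjugation-invariant character of
  \<open>R\<close>, so \<open>section_cochain_trivialized\<close> applies. Later facts about
  transgression rest on this description alone.\<close>

lemma transgression_trivialized:
  assumes \<mu>: "is_section (F Mod N) (F Mod R) (quotient_proj F R) \<mu>"
    and \<chi>: "\<chi> \<in> carrier (Hom_group M QZ)"
  shows "\<exists>\<alpha> \<phi>. \<alpha> \<in> carrier (C2 (F Mod R) QZ) \<and> trivializes F (\<lambda>u. R #>\<^bsub>F\<^esub> u) QZ \<phi> \<alpha> \<and>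
    transgression (F Mod N) (F Mod R) QZ \<mu> \<chi> = H2_class (F Mod R) QZ \<alpha> \<and>
    (\<forall>r\<in>R. cov.kernel_char \<phi> r = \<chi> (N #>\<^bsub>F\<^esub> r))"
proof -
  have "\<exists>u\<in>carrier F. \<mu> x = N #>\<^bsub>F\<^esub> u" if "x \<in> carrier (F Mod R)" for x
  proof -
    have "\<mu> x \<in> carrier (F Mod N)" using \<mu> that by (auto simp: is_section_def)
    then show ?thesis by (auto simp: carrier_FactGroup)
  qed
  then obtain m where m: "\<And>x. x \<in> carrier (F Mod R) \<Longrightarrow> m x \<in> carrier F"
    and \<mu>m: "\<And>x. x \<in> carrier (F Mod R) \<Longrightarrow> \<mu> x = N #>\<^bsub>F\<^esub> m x" by metis
  \<comment> \<open>As \<open>N\<close> lies in \<open>R\<close>, the product R N is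
    \<open>R\<close>, so projecting the coset of \<open>m x\<close> in \<open>F Mod N\<close> gives
    its coset in \<open>F Mod R\<close>.\<close>
  have proj: "R #>\<^bsub>F\<^esub> m x = x" if x: "x \<in> carrier (F Mod R)" for x
  proof -
    have "x = R <#>\<^bsub>F\<^esub> (N #>\<^bsub>F\<^esub> m x)"
      using \<mu> x unfolding is_section_def quotient_proj_def \<mu>m[OF x, symmetric] by simp
    also have "\<dots> = R <#>\<^bsub>F\<^esub> N #>\<^bsub>F\<^esub> m x"
      by (rule R.setmult_rcos_assoc[OF R.subset N.subset m[OF x]])
    also have "R <#>\<^bsub>F\<^esub> N = R"
      using R.set_mult_subgroup_idem[OF R.subgroup_axioms normal_imp_subgroup[OF N_normal_R]] .
    finally show ?thesis by simp
  qed
  let ?\<theta> = "\<lambda>r. \<chi> (N #>\<^bsub>F\<^esub> r)"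
  let ?\<alpha> = "\<lambda>(x, y)\<in>carrier (F Mod R) \<times> carrier (F Mod R).
      ?\<theta> (m x \<otimes>\<^bsub>F\<^esub> m y \<otimes>\<^bsub>F\<^esub> inv\<^bsub>F\<^esub> m (x \<otimes>\<^bsub>F Mod R\<^esub> y))"
  have \<theta>: "?\<theta> \<in> hom (F\<lparr>carrier := kernel F (F Mod R) (\<lambda>u. R #>\<^bsub>F\<^esub> u)\<rparr>) QZ"
    using Hom_M_inflate[OF \<chi>] by (simp add: kernel_eq)
  have central: "?\<theta> (u \<otimes>\<^bsub>F\<^esub> r \<otimes>\<^bsub>F\<^esub> inv\<^bsub>F\<^esub> u) = ?\<theta> r"
    if "u \<in> carrier F" "r \<in> kernel F (F Mod R) (\<lambda>u. R #>\<^bsub>F\<^esub> u)" for u r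
    using Hom_M_central[OF \<chi>] that by (simp add: kernel_eq)
  note s = cov.section_cochain_trivialized[OF \<theta> central m proj]
  interpret q: group_hom F "F Mod N" "\<lambda>u. N #>\<^bsub>F\<^esub> u"
    using N.r_coset_hom_Mod N.factorgroup_is_group
    by (simp add: group_hom_def group_hom_axioms_def R.is_group)
  have "\<mu> x \<otimes>\<^bsub>F Mod N\<^esub> \<mu> y \<otimes>\<^bsub>F Mod N\<^esub> inv\<^bsub>F Mod N\<^esub> \<mu> (x \<otimes>\<^bsub>F Mod R\<^esub> y) =
      N #>\<^bsub>F\<^esub> (m x \<otimes>\<^bsub>F\<^esub> m y \<otimes>\<^bsub>F\<^esub> inv\<^bsub>F\<^esub> m (x \<otimes>\<^bsub>F Mod R\<^esub> y))"
    if xy: "x \<in> carrier (F Mod R)" "y \<in> carrier (F Mod R)" for x y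
  proof -
    have "x \<otimes>\<^bsub>F Mod R\<^esub> y \<in> carrier (F Mod R)"
      using xy by (rule monoid.m_closed[OF group.is_monoid[OF group_G]])
    then show ?thesis using xy m
      by (simp only: \<mu>m q.hom_mult q.hom_inv R.inv_closed R.m_closed)
  qed
  then have "transgression (F Mod N) (F Mod R) QZ \<mu> \<chi> = H2_class (F Mod R) QZ ?\<alpha>"
    unfolding transgression_def by (intro arg_cong[where f = "H2_class (F Mod R) QZ"]) (auto intro!: restrict_ext)
  moreover have "\<forall>r\<in>R. cov.kernel_char (\<lambda>u. ?\<theta> (u \<otimes>\<^bsub>F\<^esub> inv\<^bsub>F\<^esub> m (R #>\<^bsub>F\<^esub> u))) r = ?\<theta> r"
    using s(3) unfolding kernel_eq by blast
  ultimately show ?thesis using s(1,2) by blast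
qed

text \<open>Passes from the commutators in \<open>R\<close> to the subgroup they generate, on which
  the character, being a homomorphism, is trivial as soon as it is on generators.\<close>

lemma Bogomolov_iff_trivial_on_N:
  assumes \<phi>: "trivializes F (\<lambda>u. R #>\<^bsub>F\<^esub> u) QZ \<phi> \<alpha>" and \<alpha>: "\<alpha> \<in> carrier (C2 (F Mod R) QZ)"
  shows "H2_class (F Mod R) QZ \<alpha> \<in> carrier (Bogomolov_multiplier (F Mod R)) \<longleftrightarrow>
    (\<forall>n\<in>N. cov.kernel_char \<phi> n = \<one>\<^bsub>QZ\<^esub>)"
proof -
  have "(\<forall>k\<in>commutators F \<inter> R. cov.kernel_char \<phi> k = \<one>\<^bsub>QZ\<^esub>) \<longleftrightarrow>
      (\<forall>n\<in>N. cov.kernel_char \<phi> n = \<one>\<^bsub>QZ\<^esub>)"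
  proof (intro iffI ballI)
    fix n assume t: "\<forall>k\<in>commutators F \<inter> R. cov.kernel_char \<phi> k = \<one>\<^bsub>QZ\<^esub>" and n: "n \<in> N"
    have "cov.kernel_char \<phi> \<in> hom (F\<lparr>carrier := R\<rparr>) QZ"
      using cov.kernel_char_hom[OF \<phi> \<alpha>] by (simp add: kernel_eq)
    then show "cov.kernel_char \<phi> n = \<one>\<^bsub>QZ\<^esub>"
    proof (rule R.hom_trivial_on_generate[OF R.subgroup_axioms QZ.is_group])
      show "n \<in> generate F (commutators F \<inter> R)" using n by (simp add: N_eq)
    qed (use t in auto)
  qed (auto intro: N_incl)
  then show ?thesis
    using Bogomolov_multiplier_class_iff[OF group_G cov.triv_Z2[OF \<phi> \<alpha>]]
      cov.locally_coboundary_iff[OF \<phi> \<alpha> divisible_QZ] by (simp add: kernel_eq)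
qed

section \<open>Transgression as an epimorphism onto the Bogomolov multiplier\<close>

context
  fixes \<mu>
  assumes \<mu>: "is_section (F Mod N) (F Mod R) (quotient_proj F R) \<mu>"
begin

abbreviation "tra \<equiv> transgression (F Mod N) (F Mod R) QZ \<mu>"

lemma tra_in_Bogomolov:
  assumes "\<chi> \<in> carrier (Hom_group M QZ)"
  shows "tra \<chi> \<in> carrier (Bogomolov_multiplier (F Mod R))"
proof -
  obtain \<phi> \<alpha> where t: "\<alpha> \<in> carrier (C2 (F Mod R) QZ)" "trivializes F (\<lambda>u. R #>\<^bsub>F\<^esub> u) QZ \<phi> \<alpha>"
    "tra \<chi> = H2_class (F Mod R) QZ \<alpha>"
    "\<forall>r\<in>R. cov.kernel_char \<phi> r = \<chi> (N #>\<^bsub>F\<^esub> r)"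
    using transgression_trivialized[OF \<mu> assms] by blast
  have "cov.kernel_char \<phi> n = \<one>\<^bsub>QZ\<^esub>" if "n \<in> N" for n
    using bspec[OF t(4), of n] Hom_M_trivial_on_N[OF assms that] that N_subset_R by auto
  then show ?thesis using Bogomolov_iff_trivial_on_N[OF t(2,1)] t(3) by simp
qed

text \<open>The cocycle of a product of characters and the product of their cocycles have
  trivializations with the same character on \<open>R\<close>, so \<open>H2_class_eqI\<close>
  identifies their classes.\<close>

lemma tra_hom: "tra \<in> hom (Hom_group M QZ) (H2 (F Mod R) QZ)"
proof (rule homI)
  fix \<chi> \<psi> assume \<chi>: "\<chi> \<in> carrier (Hom_group M QZ)" and \<psi>: "\<psi> \<in> carrier (Hom_group M QZ)"
  interpret Hom: comm_group "Hom_group M QZ"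
    by (rule comm_group_Hom_group[OF normal.factorgroup_is_group[OF N_normal_R] comm_group_QZ])
  obtain \<phi> \<alpha> where a: "\<alpha> \<in> carrier (C2 (F Mod R) QZ)" "trivializes F (\<lambda>u. R #>\<^bsub>F\<^esub> u) QZ \<phi> \<alpha>"
    "tra \<chi> = H2_class (F Mod R) QZ \<alpha>"
    "\<forall>r\<in>R. cov.kernel_char \<phi> r = \<chi> (N #>\<^bsub>F\<^esub> r)"
    using transgression_trivialized[OF \<mu> \<chi>] by blast
  obtain \<phi>' \<beta> where b: "\<beta> \<in> carrier (C2 (F Mod R) QZ)" "trivializes F (\<lambda>u. R #>\<^bsub>F\<^esub> u) QZ \<phi>' \<beta>"
    "tra \<psi> = H2_class (F Mod R) QZ \<beta>"
    "\<forall>r\<in>R. cov.kernel_char \<phi>' r = \<psi> (N #>\<^bsub>F\<^esub> r)"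
    using transgression_trivialized[OF \<mu> \<psi>] by blast
  obtain \<phi>'' \<gamma> where c: "\<gamma> \<in> carrier (C2 (F Mod R) QZ)" "trivializes F (\<lambda>u. R #>\<^bsub>F\<^esub> u) QZ \<phi>'' \<gamma>"
    "tra (\<chi> \<otimes>\<^bsub>Hom_group M QZ\<^esub> \<psi>) = H2_class (F Mod R) QZ \<gamma>"
    "\<forall>r\<in>R. cov.kernel_char \<phi>'' r = (\<chi> \<otimes>\<^bsub>Hom_group M QZ\<^esub> \<psi>) (N #>\<^bsub>F\<^esub> r)"
    using transgression_trivialized[OF \<mu> Hom.m_closed[OF \<chi> \<psi>]] by blast
  note closed = cov.triv_closed[OF a(2,1)] cov.triv_closed[OF b(2,1)]
  have "H2_class (F Mod R) QZ \<gamma> = H2_class (F Mod R) QZ (\<alpha> \<otimes>\<^bsub>C2 (F Mod R) QZ\<^esub> \<beta>)"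
  proof (rule cov.H2_class_eqI[OF c(2,1) cov.trivializes_mult[OF a(2,1) b(2,1)]], unfold kernel_eq)
    show "\<alpha> \<otimes>\<^bsub>C2 (F Mod R) QZ\<^esub> \<beta> \<in> carrier (C2 (F Mod R) QZ)" using a(1) b(1) by (rule cov.C2.m_closed)
    fix r assume r: "r \<in> R"
    then have "cov.kernel_char (\<lambda>u. \<phi> u \<otimes>\<^bsub>QZ\<^esub> \<phi>' u) r = cov.kernel_char \<phi> r \<otimes>\<^bsub>QZ\<^esub> cov.kernel_char \<phi>' r"
      using closed R.mem_carrier by (intro cov.kernel_char_mult) auto
    then show "cov.kernel_char \<phi>'' r = cov.kernel_char (\<lambda>u. \<phi> u \<otimes>\<^bsub>QZ\<^esub> \<phi>' u) r"
      using r a(4) b(4) c(4) by (auto simp: mult_Hom_group carrier_M)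
  qed
  also have "\<dots> = tra \<chi> \<otimes>\<^bsub>H2 (F Mod R) QZ\<^esub> tra \<psi>"
    using hom_mult[OF cov.H2_class_hom, of \<alpha> \<beta>] cov.triv_Z2[OF a(2,1)] cov.triv_Z2[OF b(2,1)]
    by (simp add: a(3) b(3))
  finally show "tra (\<chi> \<otimes>\<^bsub>Hom_group M QZ\<^esub> \<psi>) = tra \<chi> \<otimes>\<^bsub>H2 (F Mod R) QZ\<^esub> tra \<psi>"
    by (simp add: c(3))
next
  fix \<chi> assume "\<chi> \<in> carrier (Hom_group M QZ)"
  then show "tra \<chi> \<in> carrier (H2 (F Mod R) QZ)"
    using tra_in_Bogomolov Bogomolov_multiplier_subset[OF group_G] by (auto simp: cov.carrier_H2)
qed

text \<open>Freeness trivializes a representing cocycle. The Bogomolov condition makes its character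
  on \<open>R\<close> trivial on \<open>N\<close>, so it descends to some \<chi> on
  \<open>M\<close>; the transgression of \<chi> has the same character on \<open>R\<close> and hence
  the same class.\<close>

lemma tra_surj:
  assumes "free_group F"
  shows "carrier (Bogomolov_multiplier (F Mod R)) \<subseteq> tra ` carrier (Hom_group M QZ)"
proof
  fix \<xi> assume \<xi>: "\<xi> \<in> carrier (Bogomolov_multiplier (F Mod R))"
  then obtain \<alpha> where Z: "\<alpha> \<in> Z2 (F Mod R) QZ" and \<xi>\<alpha>: "\<xi> = H2_class (F Mod R) QZ \<alpha>"
    using Bogomolov_multiplier_subset[OF group_G] by blast
  have \<alpha>: "\<alpha> \<in> carrier (C2 (F Mod R) QZ)" using Z cov.Z2_subset by blast
  obtain \<phi> where \<phi>: "trivializes F (\<lambda>u. R #>\<^bsub>F\<^esub> u) QZ \<phi> \<alpha>"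
    using free_group_trivializes[OF assms group_G comm_group_QZ R.r_coset_hom_Mod Z] .
  have tr: "cov.kernel_char \<phi> n = \<one>\<^bsub>QZ\<^esub>" if "n \<in> N" for n
    using Bogomolov_iff_trivial_on_N[OF \<phi> \<alpha>] \<xi> \<xi>\<alpha> that by simp
  have "cov.kernel_char \<phi> \<in> hom (F\<lparr>carrier := R\<rparr>) QZ"
    using cov.kernel_char_hom[OF \<phi> \<alpha>] by (simp add: kernel_eq)
  then obtain \<chi> where \<chi>: "\<chi> \<in> carrier (Hom_group M QZ)"
    and \<chi>\<phi>: "\<And>r. r \<in> R \<Longrightarrow> \<chi> (N #>\<^bsub>F\<^esub> r) = cov.kernel_char \<phi> r"
    by (rule Hom_M_factor) (auto simp: tr)
  obtain \<phi>' \<beta> where b: "\<beta> \<in> carrier (C2 (F Mod R) QZ)" "trivializes F (\<lambda>u. R #>\<^bsub>F\<^esub> u) QZ \<phi>' \<beta>"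
    "tra \<chi> = H2_class (F Mod R) QZ \<beta>"
    "\<forall>r\<in>R. cov.kernel_char \<phi>' r = \<chi> (N #>\<^bsub>F\<^esub> r)"
    using transgression_trivialized[OF \<mu> \<chi>] by blast
  have "H2_class (F Mod R) QZ \<alpha> = H2_class (F Mod R) QZ \<beta>"
    using b(4) \<chi>\<phi> by (intro cov.H2_class_eqI[OF \<phi> \<alpha> b(2,1)]) (simp add: kernel_eq)
  then have "\<xi> = tra \<chi>" by (simp add: \<xi>\<alpha> b(3))
  then show "\<xi> \<in> tra ` carrier (Hom_group M QZ)" using \<chi> by blast
qed

lemma tra_epi:
  assumes "free_group F"
  shows "tra \<in> epi (Hom_group M QZ) (Bogomolov_multiplier (F Mod R))"
  unfolding epi_def
proof (intro CollectI conjI equalityI)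
  have "monoid.mult (Bogomolov_multiplier (F Mod R)) = monoid.mult (H2 (F Mod R) QZ)"
    by (simp add: Bogomolov_multiplier_def)
  then show "tra \<in> hom (Hom_group M QZ) (Bogomolov_multiplier (F Mod R))"
    using tra_in_Bogomolov hom_mult[OF tra_hom] by (intro homI) simp_all
  show "tra ` carrier (Hom_group M QZ) \<subseteq> carrier (Bogomolov_multiplier (F Mod R))"
    using tra_in_Bogomolov by (rule image_subsetI)
qed (rule tra_surj[OF assms])

text \<open>The class vanishes iff the character pulled back to \<open>R\<close> extends to
  \<open>F\<close>. Commutativity of \<open>QZ\<close> makes triviality on
  \<open>F' \<inter> R\<close> necessary, and \<open>hom_extension\<close> makes it
  sufficient.\<close>

lemma tra_eq_one_iff:
  assumes \<chi>: "\<chi> \<in> carrier (Hom_group M QZ)"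
  shows "tra \<chi> = \<one>\<^bsub>H2 (F Mod R) QZ\<^esub> \<longleftrightarrow> (\<forall>r\<in>F' \<inter> R. \<chi> (N #>\<^bsub>F\<^esub> r) = \<one>\<^bsub>QZ\<^esub>)"
proof -
  obtain \<phi> \<alpha> where t: "\<alpha> \<in> carrier (C2 (F Mod R) QZ)" "trivializes F (\<lambda>u. R #>\<^bsub>F\<^esub> u) QZ \<phi> \<alpha>"
    "tra \<chi> = H2_class (F Mod R) QZ \<alpha>"
    "\<forall>r\<in>R. cov.kernel_char \<phi> r = \<chi> (N #>\<^bsub>F\<^esub> r)"
    using transgression_trivialized[OF \<mu> \<chi>] by blast
  have "tra \<chi> = \<one>\<^bsub>H2 (F Mod R) QZ\<^esub> \<longleftrightarrow> (\<exists>\<psi>\<in>hom F QZ. \<forall>r\<in>R. \<psi> r = \<chi> (N #>\<^bsub>F\<^esub> r))"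
    using cov.H2_class_eq_one_iff[OF cov.triv_Z2[OF t(2,1)]] cov.B2_iff_extends[OF t(2,1)]
    by (simp add: t(3,4) kernel_eq)
  also have "\<dots> \<longleftrightarrow> (\<forall>r\<in>F' \<inter> R. \<chi> (N #>\<^bsub>F\<^esub> r) = \<one>\<^bsub>QZ\<^esub>)"
  proof (intro iffI ballI)
    fix r assume "\<exists>\<psi>\<in>hom F QZ. \<forall>r\<in>R. \<psi> r = \<chi> (N #>\<^bsub>F\<^esub> r)" and "r \<in> F' \<inter> R"
    then show "\<chi> (N #>\<^bsub>F\<^esub> r) = \<one>\<^bsub>QZ\<^esub>"
      using R.hom_trivial_on_derived[OF comm_group_QZ] by (metis IntD1 IntD2)
  next
    assume "\<forall>r\<in>F' \<inter> R. \<chi> (N #>\<^bsub>F\<^esub> r) = \<one>\<^bsub>QZ\<^esub>"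
    then have "\<And>h. h \<in> R \<Longrightarrow> h \<in> F' \<Longrightarrow> \<chi> (N #>\<^bsub>F\<^esub> h) = \<one>\<^bsub>QZ\<^esub>" by blast
    from hom_extension[OF R.is_group divisible_QZ R.subgroup_axioms Hom_M_inflate[OF \<chi>] this]
    show "\<exists>\<psi>\<in>hom F QZ. \<forall>r\<in>R. \<psi> r = \<chi> (N #>\<^bsub>F\<^esub> r)" by metis
  qed
  finally show ?thesis .
qed

end

section \<open>Restriction of characters from \<open>M\<close> to \<open>D\<close>\<close>

definition res :: "('a set \<Rightarrow> rat set) \<Rightarrow> 'a set \<Rightarrow> rat set" where
  "res \<chi> = restrict \<chi> (carrier D)"

lemma res_hom: "res \<in> hom (Hom_group M QZ) (Hom_group D QZ)"
proof -
  interpret M: group M by (rule normal.factorgroup_is_group[OF N_normal_R])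
  interpret D: group D by (rule normal.factorgroup_is_group[OF N_normal_D])
  have sub: "carrier D \<subseteq> carrier M" unfolding carrier_M carrier_D by blast
  have eq: "x \<otimes>\<^bsub>D\<^esub> y = x \<otimes>\<^bsub>M\<^esub> y" for x y
    by (simp add: set_mult_def)
  show ?thesis
  proof (rule homI)
    fix \<chi> assume \<chi>: "\<chi> \<in> carrier (Hom_group M QZ)"
    then have \<chi>h: "\<chi> \<in> hom M QZ" by (simp only: carrier_Hom_group IntD1)
    have "\<chi> (x \<otimes>\<^bsub>M\<^esub> y) = \<chi> x \<otimes>\<^bsub>QZ\<^esub> \<chi> y" if "x \<in> carrier D" "y \<in> carrier D" for x y
      using hom_mult[OF \<chi>h] sub that by blast
    moreover have "\<chi> x \<in> carrier QZ" if "x \<in> carrier D" for x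
      using hom_in_carrier[OF \<chi>h] sub that by blast
    moreover have "x \<otimes>\<^bsub>M\<^esub> y \<in> carrier D" if "x \<in> carrier D" "y \<in> carrier D" for x y
      using D.m_closed[OF that] unfolding eq .
    ultimately show "res \<chi> \<in> carrier (Hom_group D QZ)"
      unfolding carrier_Hom_group hom_def eq res_def by auto
    fix \<psi> assume "\<psi> \<in> carrier (Hom_group M QZ)"
    show "res (\<chi> \<otimes>\<^bsub>Hom_group M QZ\<^esub> \<psi>) = res \<chi> \<otimes>\<^bsub>Hom_group D QZ\<^esub> res \<psi>"
      using sub by (auto simp: res_def mult_Hom_group fun_eq_iff)
  qed
qed

text \<open>Pull \<delta> back to \<open>F' \<inter> R\<close> and extend it to \<open>R\<close>.
  The obstruction sits on the derived subgroup of \<open>R\<close>, which is generated by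
  commutators lying in \<open>R\<close> and so is contained in \<open>N\<close>, where the pullback
  is trivial. The extension agrees with it on \<open>N\<close>, hence descends to
  \<open>M\<close>.\<close>

lemma res_epi: "res \<in> epi (Hom_group M QZ) (Hom_group D QZ)"
  unfolding epi_def
proof (intro CollectI conjI res_hom equalityI)
  show "res ` carrier (Hom_group M QZ) \<subseteq> carrier (Hom_group D QZ)"
    using res_hom by (auto simp: hom_def)
  show "carrier (Hom_group D QZ) \<subseteq> res ` carrier (Hom_group M QZ)"
  proof
    fix \<delta> assume \<delta>: "\<delta> \<in> carrier (Hom_group D QZ)"
    have \<delta>N: "\<delta> (N #>\<^bsub>F\<^esub> n) = \<one>\<^bsub>QZ\<^esub>" if "n \<in> N" for n
      using Hom_one[OF _ \<delta> N_normal_D] R.subgroup_imp_group[OF subgroup_D] that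
      by (simp add: coset_of_N)
    have h: "(\<lambda>r. \<delta> (N #>\<^bsub>F\<^esub> r)) \<in> hom (F\<lparr>carrier := R, carrier := F' \<inter> R\<rparr>) QZ"
      using Hom_group_inflate[OF N_normal_D \<delta>] by (simp add: coset_restrict)
    have "derived_set F R \<subseteq> commutators F \<inter> R"
      using R.derived_set_subset_commutators[OF R.subset] R.derived_set_incl[OF _ R.subgroup_axioms]
      by blast
    then have "derived F R \<subseteq> N" unfolding derived_def N_eq by (rule R.mono_generate)
    then have der: "derived (F\<lparr>carrier := R\<rparr>) (carrier (F\<lparr>carrier := R\<rparr>)) \<subseteq> N"
      using R.derived_consistent[OF _ R.subgroup_axioms, of R] by simp
    have "subgroup (F' \<inter> R) (F\<lparr>carrier := R\<rparr>)"
      by (rule R.subgroup_incl[OF subgroup_D R.subgroup_axioms]) simp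
    from hom_extension[OF R.subgroup_imp_group[OF R.subgroup_axioms] divisible_QZ this h]
    obtain \<psi> where \<psi>: "\<psi> \<in> hom (F\<lparr>carrier := R\<rparr>) QZ"
      and \<psi>\<delta>: "\<And>h. h \<in> F' \<inter> R \<Longrightarrow> \<psi> h = \<delta> (N #>\<^bsub>F\<^esub> h)"
      using der \<delta>N by (metis subsetD)
    have "\<psi> n = \<one>\<^bsub>QZ\<^esub>" if "n \<in> N" for n
      using \<psi>\<delta>[of n] \<delta>N[OF that] that N_subset_R N_subset_derived by auto
    then obtain \<chi> where \<chi>: "\<chi> \<in> carrier (Hom_group M QZ)"
      and \<chi>\<psi>: "\<And>r. r \<in> R \<Longrightarrow> \<chi> (N #>\<^bsub>F\<^esub> r) = \<psi> r"
      using Hom_M_factor[OF \<psi>] by blast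
    have "\<delta> = res \<chi>"
    proof (rule extensionalityI)
      show "\<delta> \<in> extensional (carrier D)" using \<delta> by (simp add: carrier_Hom_group)
      show "res \<chi> \<in> extensional (carrier D)" by (simp add: res_def)
      fix x assume x: "x \<in> carrier D"
      then obtain r where r: "r \<in> F' \<inter> R" "x = N #>\<^bsub>F\<^esub> r" by (auto simp: carrier_D)
      then show "\<delta> x = res \<chi> x" using x \<chi>\<psi>[of r] \<psi>\<delta>[of r] by (simp add: res_def)
    qed
    then show "\<delta> \<in> res ` carrier (Hom_group M QZ)" using \<chi> by blast
  qed
qed

lemma res_eq_one_iff:
  "res \<chi> = \<one>\<^bsub>Hom_group D QZ\<^esub> \<longleftrightarrow> (\<forall>r\<in>F' \<inter> R. \<chi> (N #>\<^bsub>F\<^esub> r) = \<one>\<^bsub>QZ\<^esub>)"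
proof -
  have "res \<chi> = \<one>\<^bsub>Hom_group D QZ\<^esub> \<longleftrightarrow> (\<forall>x\<in>carrier D. \<chi> x = \<one>\<^bsub>QZ\<^esub>)"
    by (auto simp: res_def one_Hom_group fun_eq_iff restrict_def)
  then show ?thesis by (auto simp: carrier_D)
qed

text \<open>The isomorphism involves no section, so one is supplied here to make transgression
  available.\<close>

lemma section_exists: "\<exists>\<mu>. is_section (F Mod N) (F Mod R) (quotient_proj F R) \<mu>"
proof -
  have "\<exists>C\<in>carrier (F Mod N). quotient_proj F R C = x" if "x \<in> carrier (F Mod R)" for x
  proof -
    obtain u where u: "u \<in> carrier F" "x = R #>\<^bsub>F\<^esub> u" using \<open>x \<in> _\<close> by (auto simp: carrier_FactGroup)
    have "R <#>\<^bsub>F\<^esub> (N #>\<^bsub>F\<^esub> u) = R <#>\<^bsub>F\<^esub> N #>\<^bsub>F\<^esub> u"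
      by (rule R.setmult_rcos_assoc[OF R.subset N.subset u(1)])
    also have "R <#>\<^bsub>F\<^esub> N = R"
      using R.set_mult_subgroup_idem[OF R.subgroup_axioms normal_imp_subgroup[OF N_normal_R]] .
    finally show ?thesis using u by (auto simp: quotient_proj_def carrier_FactGroup)
  qed
  then show ?thesis unfolding is_section_def by (metis Pi_I)
qed

text \<open>Transgression and restriction are epimorphisms from the same group, and both have as
  kernel the characters trivial on \<open>F' \<inter> R\<close>.\<close>

lemma Bogomolov_multiplier_iso:
  assumes "free_group F"
  shows "Bogomolov_multiplier (F Mod R) \<cong> Hom_group D QZ"
proof -
  obtain \<mu> where \<mu>: "is_section (F Mod N) (F Mod R) (quotient_proj F R) \<mu>"
    using section_exists by blast
  interpret HM: comm_group "Hom_group M QZ"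
    by (rule comm_group_Hom_group[OF normal.factorgroup_is_group[OF N_normal_R] comm_group_QZ])
  interpret HD: comm_group "Hom_group D QZ"
    by (rule comm_group_Hom_group[OF normal.factorgroup_is_group[OF N_normal_D] comm_group_QZ])
  interpret H2: comm_group "H2 (F Mod R) QZ" by (rule cov.comm_group_H2)
  interpret t: group_hom "Hom_group M QZ" "H2 (F Mod R) QZ" "tra \<mu>"
    using tra_hom[OF \<mu>] by (simp add: group_hom_def group_hom_axioms_def HM.is_group H2.is_group)
  have epi: "tra \<mu> \<in> epi (Hom_group M QZ) (Bogomolov_multiplier (F Mod R))"
    by (rule tra_epi[OF \<mu> assms])
  \<comment> \<open>The group structure on the Bogomolov multiplier is obtained from its being the
    image of transgression in \<open>H2\<close>.\<close>
  then have "subgroup (carrier (Bogomolov_multiplier (F Mod R))) (H2 (F Mod R) QZ)"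
    using t.img_is_subgroup by (simp add: epi_def)
  then have "group (Bogomolov_multiplier (F Mod R))"
    using H2.subgroup_imp_group by (simp add: Bogomolov_multiplier_def)
  moreover have "tra \<mu> \<chi> = \<one>\<^bsub>Bogomolov_multiplier (F Mod R)\<^esub> \<longleftrightarrow> res \<chi> = \<one>\<^bsub>Hom_group D QZ\<^esub>"
    if "\<chi> \<in> carrier (Hom_group M QZ)" for \<chi>
    using tra_eq_one_iff[OF \<mu> that] by (simp add: res_eq_one_iff Bogomolov_multiplier_def)
  ultimately show ?thesis
    by (rule iso_of_epi_same_kernel[OF HM.is_group _ HD.is_group epi res_epi])
qed

end

theorem theorem1p1:
  fixes F :: "('a, 'm) monoid_scheme" and R N :: "'a set" and G :: "'a set monoid"
  assumes "free_group F"
    and "R \<lhd> F"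
    and "G = F Mod R"
    and "finite (carrier G)"
    and "N = generate F (commutators F \<inter> R)"
  shows "(\<forall>\<mu>. is_section (F Mod N) G (quotient_proj F R) \<mu> \<longrightarrow>
            transgression (F Mod N) G QZ \<mu>
              \<in> epi (Hom_group (F\<lparr>carrier := R\<rparr> Mod N) QZ) (Bogomolov_multiplier G))
         \<and> Bogomolov_multiplier G
            \<cong> Hom_group (F\<lparr>carrier := derived F (carrier F) \<inter> R\<rparr> Mod N) QZ"
proof -
  interpret presentation F R N using assms(2,5) by (rule presentation.intro)
  show ?thesis
    unfolding assms(3) using tra_epi[OF _ assms(1)] Bogomolov_multiplier_iso[OF assms(1)] by blast
qed

end
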